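(* Let $T$ be a finite tree with a chosen root vertex and let $\mathcal{P}$ be a set of $n$ distinct vertices of $T$ (the parties), with $2\le n\le 3$. Then the DODAG-X protocol and the X-protocol, both run on the same tree $T$ with party set $\mathcal{P}$, require the same number of measurements.
   Context: Graphs are finite, simple and undirected; $N_v$ is the neighborhood of $v$ in the current graph ($v\notin N_v$), and $N_v^{(0)}$ is the neighborhood of $v$ in the initial tree $T$. Measurements act on the graph (outcome-dependent local Clifford byproducts are ignored). Graph operations. $G-v$ deletes $v$ and all incident edges. Local complementation: $\tau_v(G)=(V,\,E\,\Delta\,\{\{i,j\}: i,j\in N_v, i\ne j\})$. A $Z$-measurement is $Z[v]$: $G\mapsto G-v$. An $X$-measurement with basis $w\in N_v$ is $X[v,w]$: $G\mapsto \tau_w Z_v\tau_v\tau_w(G)$ (first $\tau_w$, then $\tau_v$, then deletion of $v$, then $\tau_w$). Each $X[v,w]$ and each $Z[v]$ counts as one measurement; the number of measurements of a protocol is the total number of $X$- and $Z$-measurements. $P_{u,v}$ denotes the (vertex set of the) unique path in $T$ from $u$ to $v$. X-protocol on $T$. For two parties $i,j$: $X$-measure each interior vertex of the shortest path $P_{i,j}$, then $Z$-measure every vertex of $N_i\cup N_j$ other than $i,j$. The three-party case $\{i,j,k\}$ is analogous, using the paths $P_{i,j}$ and $P_{j,k}$. Its measurement count is as follows. Put $Q=P_{i,j}$ for $n=2$ and $Q=P_{i,j}\cup P_{j,k}$ for $n=3$. The number of path measurements is $|Q|-n$ (every non-party vertex of $Q$), and the number of isolating $Z$-measurements is $|N_T|-|Q|$,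 where $N_T=\bigcup_{v\in Q}N_v^{(0)}$. DODAG-X protocol. The initial graph is the rooted tree $T$ with root $r$. Step 1. Select the party set $\mathcal{P}$. Step 2. For each party $i$ take $P_{i,r}$, ordered from $i$ to $r$. If vertices other than $r$ lie on $P_{i,r}$ for all $i\in\mathcal{P}$, replace the root by the one of these farthest from $r$ (only a relabeling of the root). From now on $r$ is this new root. Step 3. For parties $i\neq j$, the intersection node $a_{i,j}=a_{j,i}$ is the vertex of $P_{i,r}\cap P_{j,r}$ farthest from $r$. Step 4. For each party $i\ne r$ let $a$ be its nearest intersection node, i.e. the vertex nearest to $i$ among the $a_{i,j}$ ($j\in\mathcal{P}\setminus\{i\}$) different from $i$. Perform $X[v,i]$ on each interior vertex $v$ of $P_{i,a}$, sequentially from $i$ towards $a$ (endpoints excluded). Parties that are not themselves intersection nodes are routed first. Step 5. (a) If there is only one intersection node (so it equals $r$), do nothing. (b) If some intersection node $a_{i,j}\ne r$ is itself a party, do nothing. (c) If some intersection node $a_{i,j}$ is neither the root nor a party, write $P_{a_{i,j},r}=(v_1=a_{i,j},\dots,v_m=r)$ and perform $X[v_s,v_{s-1}]$ for even $s$ in increasing order, with $v_s\notin\{a_{i,j},r\}$; if $m$ is even, add a final $X[v_{m-1},i]$, where $i$ is a party adjacent to $a_{i,j}$ after Step 4. For $n\le 3$ at most one intersection node differs from $r$. Step 6. If $r\in\mathcal{P}$, do nothing. Otherwise perform $X[r,i]$ for any party $i$ currently adjacent to $r$. Step 7. $Z$-measure every vertex that is not a party and is in the current neighborhood of some party. *)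

theory Defs
  imports "Graph_Theory.Graph_Theory"
begin

text \<open>
  A finite, simple, undirected graph is a \<^locale>\<open>pair_graph\<close>: its arc set is a finite,
  symmetric, irreflexive relation on a finite vertex set, so the edge between \<open>x\<close> and \<open>y\<close> is
  represented by the two arcs \<open>(x, y)\<close> and \<open>(y, x)\<close>.
\<close>

definition nbh :: "'a pair_pre_digraph \<Rightarrow> 'a \<Rightarrow> 'a set" where
  "nbh G v = {w. (v, w) \<in> parcs G}"

text \<open>
  \<^const>\<open>Digraph_Component.tree\<close> excludes directed cycles, among them \<open>u, v, u\<close>, and hence every
  symmetric digraph with an arc. A cycle of an undirected graph is a closed walk through at least
  three distinct vertices.
\<close>

definition undirected_tree :: "'a pair_pre_digraph \<Rightarrow> bool" where
  "undirected_tree T \<longleftrightarrow>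
     pair_graph T \<and> Digraph_Component.connected (with_proj T) \<and>
     \<not> (\<exists>p. vpath p (with_proj T) \<and> 3 \<le> length p \<and> (last p, hd p) \<in> parcs T)"

definition tree_path :: "'a pair_pre_digraph \<Rightarrow> 'a \<Rightarrow> 'a \<Rightarrow> 'a list" where
  "tree_path T u v = (THE p. vpath p (with_proj T) \<and> hd p = u \<and> last p = v)"

definition tree_dist :: "'a pair_pre_digraph \<Rightarrow> 'a \<Rightarrow> 'a \<Rightarrow> nat" where
  "tree_dist T u v = vwalk_length (tree_path T u v)"

definition interior :: "'a list \<Rightarrow> 'a list" where
  "interior p = butlast (tl p)"


section \<open>Measurements\<close>

definition local_compl :: "'a \<Rightarrow> 'a pair_pre_digraph \<Rightarrow> 'a pair_pre_digraph" where
  "local_compl v G =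
     G\<lparr>parcs := sym_diff (parcs G) {(x, y). x \<in> nbh G v \<and> y \<in> nbh G v \<and> x \<noteq> y}\<rparr>"

definition delete_vertex :: "'a \<Rightarrow> 'a pair_pre_digraph \<Rightarrow> 'a pair_pre_digraph" where
  "delete_vertex v G =
     \<lparr>pverts = pverts G - {v}, parcs = {(x, y) \<in> parcs G. x \<noteq> v \<and> y \<noteq> v}\<rparr>"

datatype 'a measurement = X_meas 'a 'a | Z_meas 'a

fun measure_vertex :: "'a measurement \<Rightarrow> 'a pair_pre_digraph \<Rightarrow> 'a pair_pre_digraph" where
  "measure_vertex (X_meas v w) G =
     local_compl w (delete_vertex v (local_compl v (local_compl w G)))"
| "measure_vertex (Z_meas v) G = delete_vertex v G"

fun admissible :: "'a measurement \<Rightarrow> 'a pair_pre_digraph \<Rightarrow> bool" where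
  "admissible (X_meas v w) G \<longleftrightarrow> v \<in> pverts G \<and> w \<in> nbh G v"
| "admissible (Z_meas v) G \<longleftrightarrow> v \<in> pverts G"

definition measure_all :: "'a measurement list \<Rightarrow> 'a pair_pre_digraph \<Rightarrow> 'a pair_pre_digraph" where
  "measure_all ms G = fold measure_vertex ms G"

fun executable :: "'a measurement list \<Rightarrow> 'a pair_pre_digraph \<Rightarrow> bool" where
  "executable [] G \<longleftrightarrow> True"
| "executable (m # ms) G \<longleftrightarrow> admissible m G \<and> executable ms (measure_vertex m G)"


section \<open>The X-protocol\<close>

fun x_path :: "'a pair_pre_digraph \<Rightarrow> 'a list \<Rightarrow> 'a set" where
  "x_path T (i # j # ps) = set (tree_path T i j) \<union> x_path T (j # ps)"
| "x_path T _ = {}"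

text \<open>
  The parties are given in the order \<open>i, j\<close> or \<open>i, j, k\<close>, so that \<^const>\<open>x_path\<close> is the path
  from \<open>i\<close> to \<open>j\<close>, united with the path from \<open>j\<close> to \<open>k\<close> for three parties. The first summand
  counts the measurements of the non-party vertices of \<open>Q\<close>, the second one the isolating
  \<open>Z\<close>-measurements. In a tree with at least two distinct parties, these lie in \<open>Q\<close> and \<open>Q\<close>
  lies in \<open>N\<close>, so neither subtraction truncates.
\<close>

definition x_protocol_count :: "'a pair_pre_digraph \<Rightarrow> 'a list \<Rightarrow> nat" where
  "x_protocol_count T ps =
     (let Q = x_path T ps; N = (\<Union>v\<in>Q. nbh T v)
      in (card Q - length ps) + (card N - card Q))"


section \<open>The DODAG-X protocol\<close>

definition new_root :: "'a pair_pre_digraph \<Rightarrow> 'a \<Rightarrow> 'a set \<Rightarrow> 'a" where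
  "new_root T r P =
     (let C = (\<Inter>i\<in>P. set (tree_path T i r)) - {r}
      in if C = {} then r else arg_max_on (tree_dist T r) C)"

text \<open>From here on, \<open>r\<close> stands for the new root.\<close>

definition intersection_node :: "'a pair_pre_digraph \<Rightarrow> 'a \<Rightarrow> 'a \<Rightarrow> 'a \<Rightarrow> 'a" where
  "intersection_node T r i j =
     arg_max_on (tree_dist T r) (set (tree_path T i r) \<inter> set (tree_path T j r))"

definition intersection_nodes :: "'a pair_pre_digraph \<Rightarrow> 'a \<Rightarrow> 'a set \<Rightarrow> 'a set" where
  "intersection_nodes T r P =
     {intersection_node T r i j | i j. i \<in> P \<and> j \<in> P \<and> i \<noteq> j}"

definition nearest_intersection :: "'a pair_pre_digraph \<Rightarrow> 'a \<Rightarrow> 'a set \<Rightarrow> 'a \<Rightarrow> 'a" where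
  "nearest_intersection T r P i =
     arg_min_on (tree_dist T i) (intersection_node T r i ` (P - {i}) - {i})"

definition route :: "'a pair_pre_digraph \<Rightarrow> 'a \<Rightarrow> 'a set \<Rightarrow> 'a \<Rightarrow> 'a measurement list" where
  "route T r P i =
     map (\<lambda>v. X_meas v i) (interior (tree_path T i (nearest_intersection T r P i)))"

text \<open>
  The protocol leaves some choices open, so each step is a relation that holds for all measurement
  sequences it allows; the current graph is an argument where the step depends on it. The
  parties are routed in any order \<open>qs\<close> that puts those which are not intersection nodes first.
\<close>

definition routing_step ::
    "'a pair_pre_digraph \<Rightarrow> 'a \<Rightarrow> 'a set \<Rightarrow> 'a measurement list \<Rightarrow> bool" where
  "routing_step T r P ms \<longleftrightarrow>
     (\<exists>qs. distinct qs \<and> set qs = P - {r} \<and>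
        sorted_wrt (\<lambda>i j. i \<in> intersection_nodes T r P \<longrightarrow> j \<in> intersection_nodes T r P) qs \<and>
        ms = concat (map (route T r P) qs))"

text \<open>
  Below, \<open>v s\<close> is the \<open>s\<close>-th vertex, counted from 1, of the path from the intersection node \<open>a\<close>
  to the root, and \<open>m\<close> is the number of its vertices; \<open>G\<close> is the graph after the routing step.
\<close>

definition connect_to_root ::
    "'a pair_pre_digraph \<Rightarrow> 'a \<Rightarrow> 'a set \<Rightarrow> 'a pair_pre_digraph \<Rightarrow> 'a \<Rightarrow> 'a measurement list \<Rightarrow> bool"
  where
  "connect_to_root T r P G a ms \<longleftrightarrow>
     (let p = tree_path T a r; m = length p; v = (\<lambda>s. p ! (s - 1));
          xs = map (\<lambda>s. X_meas (v s) (v (s - 1)))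
                 (filter (\<lambda>s. even s \<and> v s \<notin> {a, r}) [1..<m + 1])
      in if even m then \<exists>i \<in> P \<inter> nbh G a. ms = xs @ [X_meas (v (m - 1)) i] else ms = xs)"

definition intersection_step ::
    "'a pair_pre_digraph \<Rightarrow> 'a \<Rightarrow> 'a set \<Rightarrow> 'a pair_pre_digraph \<Rightarrow> 'a measurement list \<Rightarrow> bool" where
  "intersection_step T r P G ms \<longleftrightarrow>
     (let A = intersection_nodes T r P
      in (card A = 1 \<and> ms = []) \<or>
         ((\<exists>a\<in>A. a \<noteq> r \<and> a \<in> P) \<and> ms = []) \<or>
         (\<exists>a\<in>A. a \<noteq> r \<and> a \<notin> P \<and> connect_to_root T r P G a ms))"

definition root_step ::
    "'a \<Rightarrow> 'a set \<Rightarrow> 'a pair_pre_digraph \<Rightarrow> 'a measurement list \<Rightarrow> bool" where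
  "root_step r P G ms \<longleftrightarrow>
     (if r \<in> P then ms = [] else \<exists>i \<in> P \<inter> nbh G r. ms = [X_meas r i])"

definition isolating_step ::
    "'a set \<Rightarrow> 'a pair_pre_digraph \<Rightarrow> 'a measurement list \<Rightarrow> bool" where
  "isolating_step P G ms \<longleftrightarrow>
     (\<exists>zs. distinct zs \<and> set zs = (\<Union>i\<in>P. nbh G i) - P \<and> ms = map Z_meas zs)"

definition dodag_x_run ::
    "'a pair_pre_digraph \<Rightarrow> 'a \<Rightarrow> 'a set \<Rightarrow> 'a measurement list \<Rightarrow> bool" where
  "dodag_x_run T r0 P ms \<longleftrightarrow>
     (let r = new_root T r0 P
      in \<exists>ms4 ms5 ms6 ms7.
           ms = ms4 @ ms5 @ ms6 @ ms7 \<and>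
           routing_step T r P ms4 \<and>
           intersection_step T r P (measure_all ms4 T) ms5 \<and>
           root_step r P (measure_all (ms4 @ ms5) T) ms6 \<and>
           isolating_step P (measure_all (ms4 @ ms5 @ ms6) T) ms7)"

end

theory Submission
  imports Defs "HOL-Library.Z2"
begin

text \<open>
  Let \<open>Q\<close> be the subtree spanned by the parties. Both protocols measure each non-party vertex of the
  neighbourhood of \<open>Q\<close> exactly once. For DODAG-X this needs an argument: a vertex that is not
  \<open>X\<close>-measured must be adjacent to some party when the isolating step begins.

  Over the field with two elements, \<open>X[v, w]\<close> is a pivot on \<open>v, w\<close> followed by deletion of \<open>v\<close>, so
  it acts on the rows of the adjacency matrix, restricted to \<open>Q\<close>, as a linear map whose kernel is
  spanned by the row of \<open>v\<close>. A vertex attached to \<open>q \<in> Q\<close> thus ends up with no neighbour among the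
  parties only if the unit vector of \<open>q\<close> is a sum of rows of non-party vertices of \<open>Q\<close>, and in a
  tree all of whose leaves are parties it never is. This holds for any order of the measurements and
  any choice of bases, provided that every non-party vertex of \<open>Q\<close> is either measured or used once as
  a basis. It remains to trace the graph induced on \<open>Q\<close> closely enough to see that every measurement
  is possible.
\<close>

section \<open>Measurements as pivots\<close>

text \<open>The obstacle is cancellation. A pivot toggles arcs, so an arc from an outside vertex to
  a party can appear with one measurement and vanish with the next; a vertex that ends without party
  neighbours would escape the isolating step and lower the count. Tracing all these arcs through
  arbitrary orders and bases is hopeless, so the two questions are kept apart: whether each
  measurement is possible depends only on the graph induced on \<open>Q\<close>, where the
  contracted paths stay induced, while the final neighbourhoods of the parties are governed by a
  linear condition on the original tree. The bound of three parties enters through the shape of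
  \<open>Q\<close>: once the root has been moved, either all root paths are disjoint up to the root,
  or two of them merge at a single further branch vertex.\<close>

lemma pair_graph_iff:
  "pair_graph G \<longleftrightarrow> finite (pverts G) \<and>
     (\<forall>x y. (x, y) \<in> parcs G \<longrightarrow> (y, x) \<in> parcs G \<and> x \<in> pverts G \<and> x \<noteq> y)"
proof
  assume "pair_graph G"
  then interpret pair_graph G .
  show "finite (pverts G) \<and>
     (\<forall>x y. (x, y) \<in> parcs G \<longrightarrow> (y, x) \<in> parcs G \<and> x \<in> pverts G \<and> x \<noteq> y)"
    using pair_finite_verts pair_sym_arcs pair_no_loops in_arcsD1
    by (force simp: symmetric_def sym_def)
next
  assume *: "finite (pverts G) \<and>
     (\<forall>x y. (x, y) \<in> parcs G \<longrightarrow> (y, x) \<in> parcs G \<and> x \<in> pverts G \<and> x \<noteq> y)"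
  moreover have "parcs G \<subseteq> pverts G \<times> pverts G"
    using * by auto
  ultimately have "finite (parcs G)"
    by (meson finite_SigmaI finite_subset)
  moreover have "symmetric (with_proj G)"
    using * by (simp add: symmetric_def sym_def)
  moreover have "fst e \<in> pverts G" "snd e \<in> pverts G" "fst e \<noteq> snd e" if "e \<in> parcs G" for e
    using * that by (metis prod.collapse)+
  ultimately show "pair_graph G"
    using * by unfold_locales auto
qed

lemma arc_sym: "pair_graph G \<Longrightarrow> (x, y) \<in> parcs G \<longleftrightarrow> (y, x) \<in> parcs G"
  and arc_irrefl: "pair_graph G \<Longrightarrow> (x, x) \<notin> parcs G"
  and arc_in_pverts: "pair_graph G \<Longrightarrow> (x, y) \<in> parcs G \<Longrightarrow> x \<in> pverts G \<and> y \<in> pverts G"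
  by (auto simp: pair_graph_iff)

lemma mem_nbh [simp]: "w \<in> nbh G v \<longleftrightarrow> (v, w) \<in> parcs G"
  by (simp add: nbh_def)

lemma pair_graph_local_compl: "pair_graph G \<Longrightarrow> pair_graph (local_compl v G)"
  unfolding pair_graph_iff local_compl_def by (auto simp: nbh_def)

lemma pair_graph_delete_vertex: "pair_graph G \<Longrightarrow> pair_graph (delete_vertex v G)"
  unfolding pair_graph_iff delete_vertex_def by auto

lemma pair_graph_measure_vertex: "pair_graph G \<Longrightarrow> pair_graph (measure_vertex m G)"
  by (cases m) (simp_all add: pair_graph_local_compl pair_graph_delete_vertex)

lemma pair_graph_measure_all: "pair_graph G \<Longrightarrow> pair_graph (measure_all ms G)"
  unfolding measure_all_def
  by (induction ms arbitrary: G) (simp_all add: pair_graph_measure_vertex)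

lemma measure_all_Nil [simp]: "measure_all [] G = G"
  and measure_all_Cons [simp]: "measure_all (m # ms) G = measure_all ms (measure_vertex m G)"
  and measure_all_append [simp]: "measure_all (ms @ ms') G = measure_all ms' (measure_all ms G)"
  by (simp_all add: measure_all_def)

lemma executable_append [simp]:
  "executable (ms @ ms') G \<longleftrightarrow> executable ms G \<and> executable ms' (measure_all ms G)"
  by (induction ms arbitrary: G) auto

lemma pverts_local_compl [simp]: "pverts (local_compl v G) = pverts G"
  and pverts_delete_vertex [simp]: "pverts (delete_vertex v G) = pverts G - {v}"
  by (simp_all add: local_compl_def delete_vertex_def)

lemma arc_local_compl:
  "(x, y) \<in> parcs (local_compl v G) \<longleftrightarrow>
     ((x, y) \<in> parcs G) \<noteq> ((v, x) \<in> parcs G \<and> (v, y) \<in> parcs G \<and> x \<noteq> y)"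
  by (auto simp: local_compl_def)

lemma arc_delete_vertex:
  "(x, y) \<in> parcs (delete_vertex v G) \<longleftrightarrow> (x, y) \<in> parcs G \<and> x \<noteq> v \<and> y \<noteq> v"
  by (auto simp: delete_vertex_def)

context
  fixes G :: "'a pair_pre_digraph" and v w :: 'a
  assumes G: "pair_graph G" and vw: "(v, w) \<in> parcs G"
begin

text \<open>Local complementation at \<open>w\<close>, \<open>v\<close>, \<open>w\<close> is the
  pivot on the arc between them: it toggles arcs between neighbours of \<open>v\<close> and
  neighbours of \<open>w\<close>. Here \<open>\<noteq>\<close> between truth values is exclusive or.
  For \<open>x = y\<close> the two products agree by symmetry and cancel.\<close>

lemma arc_measure_X:
  assumes "x \<noteq> v" "y \<noteq> v" "x \<noteq> w" "y \<noteq> w"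
  shows "(x, y) \<in> parcs (measure_vertex (X_meas v w) G) \<longleftrightarrow>
    ((x, y) \<in> parcs G) \<noteq>
      (((x, v) \<in> parcs G \<and> (w, y) \<in> parcs G) \<noteq> ((x, w) \<in> parcs G \<and> (v, y) \<in> parcs G))"
proof -
  have "w \<noteq> v"
    using vw arc_irrefl[OF G] by blast
  then show ?thesis
    using assms vw arc_sym[OF G, of w v] arc_sym[OF G, of x v] arc_sym[OF G, of x w]
      arc_sym[OF G, of y v] arc_sym[OF G, of y w] arc_irrefl[OF G]
    by (cases "x = y") (simp add: arc_local_compl arc_delete_vertex; argo)+
qed

text \<open>A pivot also exchanges the names of \<open>v\<close> and \<open>w\<close>; once
  \<open>v\<close> is deleted, \<open>w\<close> is left with the former neighbourhood of
  \<open>v\<close>. This is what moves a party along its route.\<close>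

lemma arc_measure_X_basis:
  "(w, x) \<in> parcs (measure_vertex (X_meas v w) G) \<longleftrightarrow> (v, x) \<in> parcs G \<and> x \<noteq> w"
  using vw arc_sym[OF G, of w v] arc_sym[OF G, of x v] arc_sym[OF G, of x w] arc_irrefl[OF G]
  by (cases "x = w"; cases "x = v") (auto simp add: arc_local_compl arc_delete_vertex)

lemma not_arc_measure_X:
  "(v, x) \<notin> parcs (measure_vertex (X_meas v w) G)" "(x, v) \<notin> parcs (measure_vertex (X_meas v w) G)"
  using vw arc_irrefl[OF G]
  by (auto simp add: arc_local_compl arc_delete_vertex)

text \<open>Each correction term of the pivot formula has \<open>(x, v)\<close> or
  \<open>(x, w)\<close> as a factor, so a measurement acts only near its two vertices.\<close>

lemma nbh_measure_X_unchanged: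
  assumes "x \<noteq> w" "(x, v) \<notin> parcs G" "(x, w) \<notin> parcs G"
  shows "nbh (measure_vertex (X_meas v w) G) x = nbh G x"
proof -
  let ?G = "measure_vertex (X_meas v w) G"
  have xv: "x \<noteq> v"
    using assms vw by auto
  have "(x, y) \<in> parcs ?G \<longleftrightarrow> (x, y) \<in> parcs G" for y
  proof (cases "y = v \<or> y = w")
    case True
    then show ?thesis
      using assms xv arc_measure_X_basis[of x] not_arc_measure_X[of x]
        arc_sym[OF pair_graph_measure_vertex[OF G, of "X_meas v w"], of x w] arc_sym[OF G, of v x]
      by (auto simp del: measure_vertex.simps)
  next
    case False
    then show ?thesis
      using assms xv by (simp add: arc_measure_X del: measure_vertex.simps)
  qed
  then show ?thesis
    by (auto simp: nbh_def simp del: measure_vertex.simps)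
qed

end

declare measure_vertex.simps(1) [simp del]

lemma pverts_measure_X [simp]: "pverts (measure_vertex (X_meas v w) G) = pverts G - {v}"
  by (simp add: measure_vertex.simps)

section \<open>Sums of adjacency rows over the two-element field\<close>

definition adj :: "'a pair_pre_digraph \<Rightarrow> 'a \<Rightarrow> 'a \<Rightarrow> bit" where
  "adj G x y = of_bool ((x, y) \<in> parcs G)"

lemma adj_sym: "pair_graph G \<Longrightarrow> adj G x y = adj G y x"
  by (simp add: adj_def arc_sym[of G x y])

lemma adj_irrefl: "pair_graph G \<Longrightarrow> adj G x x = 0"
  by (simp add: adj_def arc_irrefl)

lemma adj_measure_X:
  assumes "pair_graph G" "(v, w) \<in> parcs G" "x \<noteq> v" "y \<noteq> v" "x \<noteq> w" "y \<noteq> w"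
  shows "adj (measure_vertex (X_meas v w) G) x y =
    adj G x y + adj G x v * adj G w y + adj G x w * adj G v y"
  unfolding adj_def arc_measure_X[OF assms] by auto

lemma adj_measure_X_basis:
  assumes "pair_graph G" "(v, w) \<in> parcs G" "x \<noteq> w"
  shows "adj (measure_vertex (X_meas v w) G) w x = adj G v x"
  unfolding adj_def arc_measure_X_basis[OF assms(1,2)] using assms(3) by simp

text \<open>
  No sum of rows of unused vertices \<open>U\<close> agrees with \<open>z\<close> on the parties and the unused vertices.
  The columns of vertices already used as a basis are ignored.
\<close>

definition nondeg :: "'a pair_pre_digraph \<Rightarrow> 'a set \<Rightarrow> 'a set \<Rightarrow> ('a \<Rightarrow> bit) \<Rightarrow> bool" where
  "nondeg G P U z \<longleftrightarrow> (\<forall>S\<subseteq>U. \<exists>x\<in>P \<union> U. z x + (\<Sum>s\<in>S. adj G s x) \<noteq> 0)"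

lemma bit_add_self [simp]: "(a::bit) + a = 0" "(a::bit) + (a + b) = b"
  by (cases a; simp)+

text \<open>\<open>z'\<close> is the image of \<open>z\<close> under the linear map by which the
  pivot acts on rows. A vanishing combination \<open>S\<close> after the measurement is pulled back:
  adding the rows of \<open>v\<close> and \<open>w\<close> where needed gives a vanishing
  combination \<open>S'\<close> before it. The value \<open>z' w\<close> is prescribed only for a
  party \<open>w\<close>, since otherwise \<open>w\<close> leaves the columns under
  consideration.\<close>

lemma nondeg_measure_X:
  fixes z z' :: "'a \<Rightarrow> bit"
  assumes G: "pair_graph G" and vw: "(v, w) \<in> parcs G"
    and U: "finite U" "v \<in> U" "w \<in> P \<union> U" "P \<inter> U = {}"
    and nd: "nondeg G P U z"
    and z'w: "w \<in> P \<Longrightarrow> z' w = z v"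
    and z': "\<And>x. x \<in> P \<union> U \<Longrightarrow> x \<noteq> v \<Longrightarrow> x \<noteq> w \<Longrightarrow> z' x = z x + z v * adj G w x + z w * adj G v x"
  shows "nondeg (measure_vertex (X_meas v w) G) P (U - {v, w}) z'"
  unfolding nondeg_def
proof (intro allI impI, rule ccontr)
  let ?G = "measure_vertex (X_meas v w) G"
  fix S assume S: "S \<subseteq> U - {v, w}"
    and "\<not> (\<exists>x\<in>P \<union> (U - {v, w}). z' x + (\<Sum>s\<in>S. adj ?G s x) \<noteq> 0)"
  then have zero: "z' x + (\<Sum>s\<in>S. adj ?G s x) = 0" if "x \<in> P \<union> (U - {v, w})" for x
    using that by blast
  have fin: "finite S" and vS: "v \<notin> S" and wS: "w \<notin> S" and "v \<noteq> w"
    using S U vw arc_irrefl[OF G] by (auto intro: finite_subset)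
  define f where "f x = z x + (\<Sum>s\<in>S. adj G s x)" for x
  \<comment> \<open>The row of a party may not enter the combination, so the coefficient of
    \<open>w\<close> has to vanish. It does, because column \<open>w\<close> of the new matrix is
    column \<open>v\<close> of the old one.\<close>
  have fw: "f v = 0" if "w \<in> P"
  proof -
    have "adj ?G s w = adj G s v" if "s \<in> S" for s
      using that wS adj_measure_X_basis[OF G vw, of s] adj_sym[OF pair_graph_measure_vertex[OF G]]
        adj_sym[OF G] by metis
    then show ?thesis
      using zero[of w] z'w that by (simp add: f_def cong: sum.cong)
  qed
  have fx: "f x + f v * adj G w x + f w * adj G v x = 0" if x: "x \<in> P \<union> U" "x \<noteq> v" "x \<noteq> w" for x
  proof -
    have "(\<Sum>s\<in>S. adj ?G s x)
        = (\<Sum>s\<in>S. adj G s x + adj G s v * adj G w x + adj G s w * adj G v x)"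
      using x vS wS by (intro sum.cong refl adj_measure_X[OF G vw]) auto
    also have "\<dots> = (\<Sum>s\<in>S. adj G s x) + (\<Sum>s\<in>S. adj G s v) * adj G w x
        + (\<Sum>s\<in>S. adj G s w) * adj G v x"
      by (simp only: sum.distrib sum_distrib_right)
    finally have "f x + f v * adj G w x + f w * adj G v x = z' x + (\<Sum>s\<in>S. adj ?G s x)"
      unfolding f_def z'[OF x] by (simp only: distrib_right add_ac)
    then show ?thesis
      using zero[of x] x by simp
  qed
  \<comment> \<open>As \<open>v\<close> and \<open>w\<close> are adjacent, the row of
    \<open>w\<close> corrects the entry at \<open>v\<close>, and the row of \<open>v\<close>
    corrects the entry at \<open>w\<close>.\<close>
  define S' where "S' = S \<union> (if f v = 0 then {} else {w}) \<union> (if f w = 0 then {} else {v})"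
  have S'U: "S' \<subseteq> U"
    using S U fw by (auto simp: S'_def)
  have "z x + (\<Sum>s\<in>S'. adj G s x) = f x + f v * adj G w x + f w * adj G v x" for x
    using fin vS wS \<open>v \<noteq> w\<close> unfolding S'_def f_def[of x]
    by (cases "f v"; cases "f w") (auto simp: algebra_simps)
  moreover obtain x where x: "x \<in> P \<union> U" "z x + (\<Sum>s\<in>S'. adj G s x) \<noteq> 0"
    using nd S'U unfolding nondeg_def by blast
  ultimately have ne: "f x + f v * adj G w x + f w * adj G v x \<noteq> 0"
    by simp
  have vw1: "adj G w v = 1" "adj G v w = 1"
    using vw adj_sym[OF G, of v w] by (auto simp: adj_def)
  show False
  proof (cases "x = v \<or> x = w")
    case True
    then show ?thesis
      using ne vw1 adj_irrefl[OF G] by auto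
  next
    case False
    then show ?thesis
      using ne fx x by blast
  qed
qed

section \<open>Sequences of X-measurements\<close>

abbreviation X_measures :: "('a \<times> 'a) list \<Rightarrow> 'a measurement list" where
  "X_measures \<equiv> map (\<lambda>(v, w). X_meas v w)"

text \<open>
  If this list is distinct, then no vertex outside \<open>P\<close> is measured after serving as a basis or serves
  twice.
\<close>

definition consumed :: "'a set \<Rightarrow> ('a \<times> 'a) list \<Rightarrow> 'a list" where
  "consumed P vws = map fst vws @ filter (\<lambda>w. w \<notin> P) (map snd vws)"

lemma nondeg_cong:
  assumes "\<And>x. x \<in> P \<union> U \<Longrightarrow> z x = z' x"
  shows "nondeg G P U z \<longleftrightarrow> nondeg G P U z'"
  unfolding nondeg_def by (intro all_cong imp_cong refl bex_cong) (simp only: assms)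

lemma X_measures_reach_party:
  assumes "pair_graph G" "executable (X_measures vws) G"
    and "finite U" "P \<inter> U = {}"
    and "distinct (consumed P vws)" "set (consumed P vws) = U"
    and "\<And>y. y \<in> Y \<Longrightarrow> y \<notin> P \<union> U" "\<And>y. y \<in> Y \<Longrightarrow> nondeg G P U (adj G y)"
    and "\<And>q. q \<in> U \<Longrightarrow> nondeg G P U (\<lambda>x. of_bool (x = q))"
    and "y \<in> Y \<union> (U - fst ` set vws)"
  shows "\<exists>x\<in>P. (y, x) \<in> parcs (measure_all (X_measures vws) G)"
  using assms
proof (induction vws arbitrary: G U Y y)
  case Nil
  then have "U = {}" "y \<in> Y"
    by (auto simp: consumed_def)
  with Nil.prems(8) show ?case
    by (auto simp: nondeg_def adj_def)
next
  case (Cons vw vws)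
  obtain v w where vw_eq: "vw = (v, w)"
    by force
  note prems = Cons.prems[unfolded vw_eq]
  note G = prems(1)
  let ?G = "measure_vertex (X_meas v w) G"
  let ?U = "U - {v, w}"
  let ?Y = "if w \<in> P then Y else insert w Y"
  have vw: "(v, w) \<in> parcs G" and exec: "executable (X_measures vws) ?G"
    using prems(2) by simp_all
  have G': "pair_graph ?G"
    by (rule pair_graph_measure_vertex[OF G])
  have vU: "v \<in> U" and wU: "w \<in> P \<union> U"
    using prems(6) by (auto simp: consumed_def)
  have set': "distinct (consumed P vws)" "set (consumed P vws) = ?U"
    using prems(4-6) vU by (auto simp: consumed_def split: if_splits)
  have "v \<noteq> w"
    using vw arc_irrefl[OF G] by blast
  note step = nondeg_measure_X[OF G vw prems(3) vU wU prems(4)]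
  have Y1: "nondeg ?G P ?U (adj ?G y)" if y: "y \<in> Y" for y
  proof (rule step[OF prems(8)[OF y]])
    have "y \<noteq> v" "y \<noteq> w"
      using prems(7)[OF y] vU wU by auto
    then show "adj ?G y w = adj G y v"
      using adj_measure_X_basis[OF G vw, of y] adj_sym[OF G] adj_sym[OF G'] by metis
    fix x assume "x \<noteq> v" "x \<noteq> w"
    then show "adj ?G y x = adj G y x + adj G y v * adj G w x + adj G y w * adj G v x"
      using adj_measure_X[OF G vw] \<open>y \<noteq> v\<close> \<open>y \<noteq> w\<close> by blast
  qed
  \<comment> \<open>The new row of \<open>w\<close> is the old row of \<open>v\<close>, which off
    \<open>v\<close> and \<open>w\<close> is the pivot image of the unit vector of
    \<open>w\<close>.\<close>
  have Y2: "nondeg ?G P ?U (adj ?G w)" if "w \<notin> P"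
  proof (rule step[OF prems(9)[of w]])
    show "w \<in> U"
      using wU that by blast
    fix x assume "x \<noteq> v" "x \<noteq> w"
    then show "adj ?G w x = of_bool (x = w) + of_bool (v = w) * adj G w x + of_bool (w = w) * adj G v x"
      using adj_measure_X_basis[OF G vw, of x] \<open>v \<noteq> w\<close> by simp
  qed (use that in blast)
  have "\<exists>x\<in>P. (y, x) \<in> parcs (measure_all (X_measures vws) ?G)"
  proof (rule Cons.IH[OF G' exec, of ?U ?Y])
    \<comment> \<open>The unit vector of a vertex other than \<open>v\<close> and \<open>w\<close>
      is fixed by the pivot, as both correction terms vanish.\<close>
    show "nondeg ?G P ?U (\<lambda>x. of_bool (x = q))" if "q \<in> ?U" for q
      by (rule step[OF prems(9)[of q]]) (use that prems(4) in auto)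
    show "nondeg ?G P ?U (adj ?G y)" if "y \<in> ?Y" for y
      using that Y1 Y2 by (auto split: if_splits)
    show "y \<notin> P \<union> ?U" if "y \<in> ?Y" for y
      using that prems(7) by (auto split: if_splits)
    show "y \<in> ?Y \<union> (?U - fst ` set vws)"
      using prems(4,7,10) wU by auto
  qed (use prems set' in auto)
  then show ?case
    by (simp add: vw_eq)
qed

lemma X_measures_pverts: "pverts (measure_all (X_measures vws) G) = pverts G - fst ` set vws"
  by (induction vws arbitrary: G) auto

lemma nbh_measure_X_subset:
  assumes "pair_graph G" "(v, w) \<in> parcs G"
  shows "nbh (measure_vertex (X_meas v w) G) x \<subseteq> nbh G x \<union> nbh G v \<union> nbh G w"
proof
  let ?G = "measure_vertex (X_meas v w) G"
  fix y assume y: "y \<in> nbh ?G x"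
  have G': "pair_graph ?G"
    by (rule pair_graph_measure_vertex[OF assms(1)])
  show "y \<in> nbh G x \<union> nbh G v \<union> nbh G w"
  proof (cases "x \<in> {v, w} \<or> y \<in> {v, w}")
    case True
    then show ?thesis
      using y not_arc_measure_X[OF assms] arc_measure_X_basis[OF assms] assms(2)
        arc_sym[OF assms(1), of w v] by auto
  next
    case False
    then show ?thesis
      using y arc_measure_X[OF assms, of x y] by auto
  qed
qed

text \<open>A pivot on two vertices of \<open>Q\<close> merges neighbourhoods of vertices of
  \<open>Q\<close> and thus never leads out of \<open>N\<close>; measured vertices are gone. This
  bounds the isolating measurements from above.\<close>

lemma X_measures_nbh_subset:
  assumes "pair_graph G" "executable (X_measures vws) G"
    and "set vws \<subseteq> Q \<times> Q" "\<And>x. x \<in> Q \<Longrightarrow> nbh G x \<subseteq> N" "x \<in> Q"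
  shows "nbh (measure_all (X_measures vws) G) x \<subseteq> N - fst ` set vws"
proof -
  have "nbh (measure_all (X_measures vws) G) x \<subseteq> N"
    using assms
  proof (induction vws arbitrary: G)
    case (Cons vw vws)
    obtain v w where vw_eq: "vw = (v, w)"
      by force
    let ?G = "measure_vertex (X_meas v w) G"
    have vw: "(v, w) \<in> parcs G"
      using Cons.prems(2) by (simp add: vw_eq)
    have N: "nbh ?G x \<subseteq> N" if "x \<in> Q" for x
    proof -
      have "v \<in> Q" "w \<in> Q"
        using Cons.prems(3) by (auto simp: vw_eq)
      then show ?thesis
        using nbh_measure_X_subset[OF Cons.prems(1) vw, of x] Cons.prems(4)[of x]
          Cons.prems(4)[of v] Cons.prems(4)[of w] that by blast
    qed
    have "nbh (measure_all (X_measures vws) ?G) x \<subseteq> N"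
    proof (rule Cons.IH[OF pair_graph_measure_vertex[OF Cons.prems(1)] _ _ N])
      show "executable (X_measures vws) ?G"
        using Cons.prems(2) by (simp add: vw_eq)
    qed (use Cons.prems(3,5) in auto)
    then show ?case
      by (simp add: vw_eq)
  qed auto
  moreover have "nbh (measure_all (X_measures vws) G) x \<inter> fst ` set vws = {}"
    using arc_in_pverts[OF pair_graph_measure_all[OF assms(1)], of x _ "X_measures vws"]
    unfolding X_measures_pverts by (auto simp: nbh_def; blast)
  ultimately show ?thesis
    by blast
qed

lemma executable_Z: "distinct zs \<Longrightarrow> set zs \<subseteq> pverts G \<Longrightarrow> executable (map Z_meas zs) G"
proof (induction zs arbitrary: G)
  case (Cons z zs)
  then have "executable (map Z_meas zs) (delete_vertex z G)"
    by (intro Cons.IH) auto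
  with Cons.prems show ?case
    by simp
qed simp

text \<open>
  A vertex measured in the isolating step is either outside \<open>Q\<close> or has served as a basis; the count
  therefore does not depend on how the vertices of \<open>Q\<close> are split between the two roles.
\<close>

lemma isolating_step_count:
  fixes T :: "'a pair_pre_digraph"
  defines "N Q \<equiv> \<Union>v\<in>Q. nbh T v"
  assumes T: "pair_graph T" and Q: "finite Q" "P \<subseteq> Q" "Q \<subseteq> N Q"
    and ms: "executable (X_measures vws) T" "set vws \<subseteq> Q \<times> Q"
    and cons: "distinct (consumed P vws)" "set (consumed P vws) = Q - P"
    and one: "\<And>y. y \<in> N Q - Q \<Longrightarrow> \<exists>q\<in>Q. nbh T y \<inter> Q = {q}"
    and basis: "\<And>q. q \<in> Q \<Longrightarrow> nondeg T P (Q - P) (\<lambda>x. of_bool (x = q))"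
    and iso: "isolating_step P (measure_all (X_measures vws) T) zms"
  shows "executable (X_measures vws @ zms) T"
    and "length (X_measures vws @ zms) = (card Q - card P) + (card (N Q) - card Q)"
proof -
  let ?G = "measure_all (X_measures vws) T"
  let ?M = "fst ` set vws"
  have G: "pair_graph ?G"
    by (rule pair_graph_measure_all[OF T])
  obtain zs where zs: "distinct zs" "set zs = (\<Union>i\<in>P. nbh ?G i) - P" "zms = map Z_meas zs"
    using iso unfolding isolating_step_def by blast
  have "set zs \<subseteq> pverts ?G"
    using zs(2) arc_in_pverts[OF G] by auto
  then show "executable (X_measures vws @ zms) T"
    using ms(1) executable_Z[OF zs(1), of ?G] unfolding zs(3) by simp
  have M: "?M \<subseteq> Q - P"
    using cons(2) by (auto simp: consumed_def)
  \<comment> \<open>Locality of the pivots gives one inclusion, nondegeneracy the other.\<close>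
  have "set zs = N Q - P - ?M"
  proof
    show "set zs \<subseteq> N Q - P - ?M"
      using X_measures_nbh_subset[OF T ms, of "N Q"] Q(2) unfolding zs(2) N_def by blast
    show "N Q - P - ?M \<subseteq> set zs"
    proof
      fix y assume y: "y \<in> N Q - P - ?M"
      have "\<exists>x\<in>P. (y, x) \<in> parcs ?G"
      proof (rule X_measures_reach_party[OF T ms(1) _ _ cons, of "N Q - Q"])
        fix y assume y: "y \<in> N Q - Q"
        then show "y \<notin> P \<union> (Q - P)"
          using Q by blast
        obtain q where q: "q \<in> Q" "nbh T y \<inter> Q = {q}"
          using one[OF y] by blast
        \<comment> \<open>A vertex outside \<open>Q\<close> has one neighbour in \<open>Q\<close>,
          so its row, read on \<open>Q\<close>, is a unit vector.\<close>
        have "adj T y x = of_bool (x = q)" if "x \<in> P \<union> (Q - P)" for x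
          using that Q(2) q(2) by (auto simp: adj_def nbh_def)
        then show "nondeg T P (Q - P) (adj T y)"
          by (rule iffD2[OF nondeg_cong basis[OF q(1)]])
      qed (use y Q basis in auto)
      then show "y \<in> set zs"
        using zs(2) y arc_sym[OF G] by auto
    qed
  qed
  moreover have finN: "finite (N Q)"
    using T arc_in_pverts[OF T] unfolding N_def pair_graph_iff
    by (auto intro!: finite_subset[of _ "pverts T"])
  moreover have "distinct (map fst vws)"
    using cons(1) by (simp add: consumed_def)
  then have "card ?M = length vws"
    using distinct_card[of "map fst vws"] by simp
  moreover have fin: "finite P" "finite ?M" "?M \<subseteq> N Q" "P \<subseteq> N Q" "?M \<inter> P = {}"
    using Q M finite_subset by auto
  moreover have "?M \<subseteq> N Q - P"
    using fin by blast
  ultimately have "length zs = card (N Q) - card P - length vws"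
    using distinct_card[OF zs(1)] card_Diff_subset[of P "N Q"] card_Diff_subset[of ?M "N Q - P"]
    by simp
  \<comment> \<open>Rules out truncation in the subtraction of natural numbers.\<close>
  moreover have "card P + length vws \<le> card (N Q)"
    using card_mono[OF finN, of "P \<union> ?M"] card_Un_disjoint[of P ?M] fin \<open>card ?M = length vws\<close>
    by (simp add: Int_commute)
  moreover have "card P \<le> card Q" "card Q \<le> card (N Q)"
    using card_mono Q finN by auto
  ultimately show "length (X_measures vws @ zms) = (card Q - card P) + (card (N Q) - card Q)"
    using zs(3) by simp
qed


section \<open>Contracting induced paths\<close>

text \<open>An induced path, listed from end to end. Only arcs from earlier to later vertices are
  tested, which suffices in a symmetric graph. For empty \<open>p\<close> the quantifier is vacuous,
  so \<open>hd []\<close> is harmless.\<close>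

fun chordless :: "'a pair_pre_digraph \<Rightarrow> 'a list \<Rightarrow> bool" where
  "chordless G [] \<longleftrightarrow> True"
| "chordless G (x # p) \<longleftrightarrow> x \<notin> set p \<and> chordless G p \<and>
     (\<forall>y\<in>set p. (x, y) \<in> parcs G \<longleftrightarrow> y = hd p)"

lemma chordless_cong:
  assumes "\<And>x y. x \<in> set p \<Longrightarrow> y \<in> set p \<Longrightarrow> (x, y) \<in> parcs G \<longleftrightarrow> (x, y) \<in> parcs H"
  shows "chordless G p \<longleftrightarrow> chordless H p"
  using assms by (induction p) auto

lemma chordless_distinct: "chordless G p \<Longrightarrow> distinct p"
  by (induction p) auto

lemma arc_eq_if_nbh_eq:
  assumes "pair_graph G" "pair_graph H" "nbh H x = nbh G x \<or> nbh H y = nbh G y"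
  shows "(x, y) \<in> parcs H \<longleftrightarrow> (x, y) \<in> parcs G"
  using assms arc_sym[OF assms(1), of x y] arc_sym[OF assms(2), of x y] by (auto simp: nbh_def)

abbreviation route_pairs :: "'a list \<Rightarrow> ('a \<times> 'a) list" where
  "route_pairs p \<equiv> map (\<lambda>v. (v, hd p)) (interior p)"

text \<open>Measuring the second vertex with the head as basis gives the head the arcs of that
  vertex; what remains is an induced path shorter by one, and the argument repeats. \<open>R\<close>
  is the part of the graph that is traced; of the path, only the last vertex may have neighbours in
  \<open>R\<close> off the path. The last claim keeps earlier results intact when further paths are
  contracted.\<close>

lemma routing:
  assumes "pair_graph G" "chordless G p" "2 \<le> length p"
    and "\<And>x y. x \<in> set (butlast p) \<Longrightarrow> y \<in> R \<Longrightarrow> (x, y) \<in> parcs G \<Longrightarrow> y \<in> set p"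
    and "last p \<in> R"
  defines "G' \<equiv> measure_all (X_measures (route_pairs p)) G"
  shows "executable (X_measures (route_pairs p)) G"
    and "\<And>x y. x \<in> R - set (butlast p) \<Longrightarrow> y \<in> R - set (butlast p) \<Longrightarrow>
           (x, y) \<in> parcs G' \<longleftrightarrow> (x, y) \<in> parcs G"
    and "\<And>y. y \<in> R - set (butlast p) \<Longrightarrow> (hd p, y) \<in> parcs G' \<longleftrightarrow> y = last p"
    and "\<And>x. x \<notin> set (butlast p) \<Longrightarrow> nbh G x \<inter> set (butlast p) = {} \<Longrightarrow> nbh G' x = nbh G x"
proof -
  have "executable (X_measures (route_pairs p)) G \<and>
    (\<forall>x y. x \<in> R - set (butlast p) \<longrightarrow> y \<in> R - set (butlast p) \<longrightarrow>
           ((x, y) \<in> parcs G' \<longleftrightarrow> (x, y) \<in> parcs G)) \<and>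
    (\<forall>y \<in> R - set (butlast p). (hd p, y) \<in> parcs G' \<longleftrightarrow> y = last p) \<and>
    (\<forall>x. x \<notin> set (butlast p) \<longrightarrow> nbh G x \<inter> set (butlast p) = {} \<longrightarrow> nbh G' x = nbh G x)"
    using assms(1-5) unfolding G'_def
  proof (induction "length p" arbitrary: p G)
    case (Suc n)
    obtain k u p' where p: "p = k # u # p'"
      using \<open>2 \<le> length p\<close> by (cases p; cases "tl p") auto
    note G = Suc.prems(1)
    show ?case
    proof (cases "p' = []")
      case True
      then have "(k, y) \<in> parcs G \<longleftrightarrow> y = u" if "y \<in> R - {k}" for y
        using Suc.prems(2) Suc.prems(4)[of k y] that by (auto simp: p)
      then show ?thesis
        using True by (simp add: p interior_def)
    next
      case False
      let ?G = "measure_vertex (X_meas u k) G"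
      let ?G' = "measure_all (X_measures (route_pairs p)) G"
      have G1: "pair_graph ?G"
        by (rule pair_graph_measure_vertex[OF G])
      have uk: "(u, k) \<in> parcs G"
        using Suc.prems(2) arc_sym[OF G, of u k] by (simp add: p)
      have G': "?G' = measure_all (X_measures (route_pairs (k # p'))) ?G"
        using False by (simp add: p interior_def)
      have k: "(k, y) \<in> parcs ?G \<longleftrightarrow> (u, y) \<in> parcs G \<and> y \<noteq> k" for y
        by (rule arc_measure_X_basis[OF G uk])
      have out: "nbh ?G y = nbh G y" if "y \<noteq> k" "(k, y) \<notin> parcs G" "(u, y) \<notin> parcs G" for y
        using nbh_measure_X_unchanged[OF G uk that(1)] that arc_sym[OF G, of y] by blast
      have tail: "nbh ?G y = nbh G y" if "y \<in> set p'" "y \<noteq> hd p'" for y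
        using that Suc.prems(2) by (intro out) (auto simp: p)
      have pair: "(x, y) \<in> parcs ?G \<longleftrightarrow> (x, y) \<in> parcs G" if "x \<in> set p'" "y \<in> set p'" for x y
      proof (cases "x = y")
        case True
        then show ?thesis
          using arc_irrefl[OF G] arc_irrefl[OF G1] by simp
      next
        case False
        then show ?thesis
          using arc_eq_if_nbh_eq[OF G G1, of x y] tail that by blast
      qed
      have ch: "chordless ?G (k # p')"
        using Suc.prems(2) k chordless_cong[of p' ?G G] pair by (auto simp: p)
      have Rout: "nbh ?G y = nbh G y" if "y \<in> R - set p" for y
        using that Suc.prems(4)[of k y] Suc.prems(4)[of u y] False by (intro out) (auto simp: p)
      have R1: "y \<in> set (k # p')"
        if x: "x \<in> set (butlast (k # p'))" and y: "y \<in> R" and xy: "(x, y) \<in> parcs ?G" for x y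
      proof -
        have "y \<in> set p"
        proof (rule ccontr)
          assume "y \<notin> set p"
          then have "(x, y) \<in> parcs G"
            using y xy Rout arc_eq_if_nbh_eq[OF G G1, of x y] by blast
          then show False
            using Suc.prems(4)[of x y] x y False \<open>y \<notin> set p\<close> by (auto simp: p split: if_splits)
        qed
        moreover have "y \<noteq> u"
          using xy not_arc_measure_X[OF G uk] by blast
        ultimately show ?thesis
          by (auto simp: p)
      qed
      have IH: "executable (X_measures (route_pairs (k # p'))) ?G \<and>
        (\<forall>x y. x \<in> R - set (butlast (k # p')) \<longrightarrow> y \<in> R - set (butlast (k # p')) \<longrightarrow>
             ((x, y) \<in> parcs ?G' \<longleftrightarrow> (x, y) \<in> parcs ?G)) \<and>
        (\<forall>y \<in> R - set (butlast (k # p')). (hd (k # p'), y) \<in> parcs ?G' \<longleftrightarrow> y = last (k # p')) \<and>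
        (\<forall>x. x \<notin> set (butlast (k # p')) \<longrightarrow> nbh ?G x \<inter> set (butlast (k # p')) = {} \<longrightarrow>
           nbh ?G' x = nbh ?G x)"
        unfolding G'
      proof (rule Suc.hyps(1)[OF _ G1 ch])
        show "n = length (k # p')"
          using Suc.hyps(2) by (simp add: p)
        show "2 \<le> length (k # p')"
          using False by (cases p') auto
        show "last (k # p') \<in> R"
          using Suc.prems(5) False by (simp add: p)
      qed (use R1 in blast)
      show ?thesis
      proof (intro conjI allI impI ballI)
        show "executable (X_measures (route_pairs p)) G"
          using IH uk False arc_in_pverts[OF G uk] by (simp add: p interior_def)
      next
        fix x y assume x: "x \<in> R - set (butlast p)" and y: "y \<in> R - set (butlast p)"
        have "(x, y) \<in> parcs ?G' \<longleftrightarrow> (x, y) \<in> parcs ?G"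
          using IH x y False by (auto simp: p)
        also have "\<dots> \<longleftrightarrow> (x, y) \<in> parcs G"
        proof (cases "x = y")
          case True
          then show ?thesis
            using arc_irrefl[OF G] arc_irrefl[OF G1] by simp
        next
          case neq: False
          \<comment> \<open>Of two distinct vertices outside the body, one is not
            \<open>last p\<close>; its neighbourhood is unchanged, and that settles the arc between
            them.\<close>
          have "z \<in> R - set p" if "z \<in> R - set (butlast p)" "z \<noteq> last p" for z
            using that append_butlast_last_id[of p] by (metis Diff_iff p in_set_butlast_appendI list.distinct(1) set_append Un_iff set_ConsD empty_set empty_iff)
          then show ?thesis
            using neq x y Rout arc_eq_if_nbh_eq[OF G G1, of x y] by metis
        qed
        finally show "(x, y) \<in> parcs ?G' \<longleftrightarrow> (x, y) \<in> parcs G" .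
      next
        fix y assume "y \<in> R - set (butlast p)"
        then show "(hd p, y) \<in> parcs ?G' \<longleftrightarrow> y = last p"
          using IH False by (auto simp: p)
      next
        fix x assume x: "x \<notin> set (butlast p)" "nbh G x \<inter> set (butlast p) = {}"
        then have "nbh ?G x = nbh G x"
          using False arc_sym[OF G, of x] by (intro out) (auto simp: p)
        moreover have "x \<notin> set (butlast (k # p'))" "nbh G x \<inter> set (butlast (k # p')) = {}"
          using x False by (auto simp: p)
        ultimately show "nbh ?G' x = nbh G x"
          using IH by simp
      qed
    qed
  qed simp
  then show "executable (X_measures (route_pairs p)) G"
    and "\<And>x y. x \<in> R - set (butlast p) \<Longrightarrow> y \<in> R - set (butlast p) \<Longrightarrow>
           (x, y) \<in> parcs G' \<longleftrightarrow> (x, y) \<in> parcs G"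
    and "\<And>y. y \<in> R - set (butlast p) \<Longrightarrow> (hd p, y) \<in> parcs G' \<longleftrightarrow> y = last p"
    and "\<And>x. x \<notin> set (butlast p) \<Longrightarrow> nbh G x \<inter> set (butlast p) = {} \<Longrightarrow> nbh G' x = nbh G x"
    by blast+
qed

text \<open>All conditions refer to \<open>T\<close> and not to the changing graph, because
  contraction preserves the graph on the remaining vertices. \<open>R\<close> loses the body of each
  path in turn: a path may have neighbours in an earlier body, and this makes the order of the list
  matter.\<close>

fun routable :: "'a pair_pre_digraph \<Rightarrow> 'a set \<Rightarrow> 'a list list \<Rightarrow> bool" where
  "routable T R [] \<longleftrightarrow> True"
| "routable T R (p # ps) \<longleftrightarrow> chordless T p \<and> 2 \<le> length p \<and> set p \<subseteq> R \<and>
     (\<forall>x\<in>set (butlast p). \<forall>y\<in>R. (x, y) \<in> parcs T \<longrightarrow> y \<in> set p) \<and>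
     routable T (R - set (butlast p)) ps"

abbreviation bodies :: "'a list list \<Rightarrow> 'a set" where
  "bodies ps \<equiv> (\<Union>p\<in>set ps. set (butlast p))"

text \<open>
  Routing contracts one path after the other and leaves the graph induced on the remaining vertices
  \<open>R - bodies ps\<close> as it was in \<open>T\<close>.
\<close>

lemma routings:
  assumes "pair_graph G" "routable T R ps"
    and "\<And>x y. x \<in> R \<Longrightarrow> y \<in> R \<Longrightarrow> (x, y) \<in> parcs G \<longleftrightarrow> (x, y) \<in> parcs T"
  defines "ms \<equiv> X_measures (concat (map route_pairs ps))"
  shows "executable ms G"
    and "\<And>x y. x \<in> R - bodies ps \<Longrightarrow> y \<in> R - bodies ps \<Longrightarrow>
           (x, y) \<in> parcs (measure_all ms G) \<longleftrightarrow> (x, y) \<in> parcs T"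
    and "\<And>h t y. h \<notin> R \<Longrightarrow> (\<And>y. y \<in> R \<Longrightarrow> (h, y) \<in> parcs G \<longleftrightarrow> y = t) \<Longrightarrow> t \<notin> bodies ps \<Longrightarrow>
           y \<in> R - bodies ps \<Longrightarrow> (h, y) \<in> parcs (measure_all ms G) \<longleftrightarrow> y = t"
    and "\<And>p y. p \<in> set ps \<Longrightarrow> last p \<notin> bodies ps \<Longrightarrow> y \<in> R - bodies ps \<Longrightarrow>
           (hd p, y) \<in> parcs (measure_all ms G) \<longleftrightarrow> y = last p"
proof -
  have "executable ms G \<and>
    (\<forall>x\<in>R - bodies ps. \<forall>y\<in>R - bodies ps. (x, y) \<in> parcs (measure_all ms G) \<longleftrightarrow> (x, y) \<in> parcs T) \<and>
    (\<forall>h t. h \<notin> R \<longrightarrow> (\<forall>y\<in>R. (h, y) \<in> parcs G \<longleftrightarrow> y = t) \<longrightarrow> t \<notin> bodies ps \<longrightarrow>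
       (\<forall>y\<in>R - bodies ps. (h, y) \<in> parcs (measure_all ms G) \<longleftrightarrow> y = t)) \<and>
    (\<forall>p\<in>set ps. last p \<notin> bodies ps \<longrightarrow>
       (\<forall>y\<in>R - bodies ps. (hd p, y) \<in> parcs (measure_all ms G) \<longleftrightarrow> y = last p))"
    using assms(1-3) unfolding ms_def
  proof (induction ps arbitrary: G R)
    case (Cons p ps)
    note G = Cons.prems(1)
    let ?b = "set (butlast p)"
    let ?G1 = "measure_all (X_measures (route_pairs p)) G"
    let ?G' = "measure_all (X_measures (concat (map route_pairs ps))) ?G1"
    have G1: "pair_graph ?G1"
      by (rule pair_graph_measure_all[OF G])
    have p: "chordless T p" "2 \<le> length p" "set p \<subseteq> R" "p \<noteq> []"
      and pR: "\<And>x y. x \<in> ?b \<Longrightarrow> y \<in> R \<Longrightarrow> (x, y) \<in> parcs T \<Longrightarrow> y \<in> set p"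
      and ps: "routable T (R - ?b) ps"
      using Cons.prems(2) by auto
    have bR: "?b \<subseteq> R"
      using p(3) by (meson in_set_butlastD subset_iff)
    have eq: "(x, y) \<in> parcs G \<longleftrightarrow> (x, y) \<in> parcs T" if "x \<in> R" "y \<in> R" for x y
      using Cons.prems(3) that by blast
    have ch: "chordless G p"
      using p chordless_cong[of p G T] eq by blast
    have lastR: "last p \<in> R"
      using p by auto
    note rt = routing[OF G ch p(2), of R, OF _ lastR]
    have pRG: "y \<in> set p" if "x \<in> ?b" "y \<in> R" "(x, y) \<in> parcs G" for x y
      using that bR eq pR by blast
    have rt1: "executable (X_measures (route_pairs p)) G"
      using rt(1) pRG by blast
    have rt2: "(x, y) \<in> parcs ?G1 \<longleftrightarrow> (x, y) \<in> parcs T" if "x \<in> R - ?b" "y \<in> R - ?b" for x y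
      using rt(2) pRG eq that by blast
    have rt3: "(hd p, y) \<in> parcs ?G1 \<longleftrightarrow> y = last p" if "y \<in> R - ?b" for y
      using rt(3) pRG that by blast
    have rt4: "nbh ?G1 x = nbh G x" if "x \<notin> ?b" "nbh G x \<inter> ?b = {}" for x
      using rt(4) pRG that by blast
    have hd_b: "hd p \<in> ?b"
      using p(2) by (cases p; cases "tl p") auto
    note IH = Cons.IH[OF G1 ps rt2]
    have R': "R - bodies (p # ps) = R - ?b - bodies ps"
      by auto
    show ?case
      unfolding R'
    proof (intro conjI ballI allI impI)
      show "executable (X_measures (concat (map route_pairs (p # ps)))) G"
        using rt1 IH by simp
    next
      fix x y assume "x \<in> R - ?b - bodies ps" "y \<in> R - ?b - bodies ps"
      then show "(x, y) \<in> parcs (measure_all (X_measures (concat (map route_pairs (p # ps)))) G)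
          \<longleftrightarrow> (x, y) \<in> parcs T"
        using IH by auto
    next
      fix h t y
      assume h: "h \<notin> R" "\<forall>y\<in>R. (h, y) \<in> parcs G \<longleftrightarrow> y = t" "t \<notin> bodies (p # ps)"
        and y: "y \<in> R - ?b - bodies ps"
      \<comment> \<open>\<open>h\<close> stands for the head of an earlier path: within
        \<open>R\<close> it sees only \<open>t\<close>, which lies in no body, so contracting
        \<open>p\<close> does not reach it.\<close>
      have "nbh ?G1 h = nbh G h"
        using h bR by (intro rt4) (auto simp: nbh_def)
      then have "\<forall>y\<in>R - ?b. (h, y) \<in> parcs ?G1 \<longleftrightarrow> y = t"
        using h(2) by (auto simp: nbh_def)
      then show "(h, y) \<in> parcs (measure_all (X_measures (concat (map route_pairs (p # ps)))) G) \<longleftrightarrow> y = t"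
        using IH h y by auto
    next
      fix q y
      assume q: "q \<in> set (p # ps)" "last q \<notin> bodies (p # ps)"
        and y: "y \<in> R - ?b - bodies ps"
      show "(hd q, y) \<in> parcs (measure_all (X_measures (concat (map route_pairs (p # ps)))) G)
          \<longleftrightarrow> y = last q"
      proof (cases "q \<in> set ps")
        case True
        then show ?thesis
          using IH q y by auto
      next
        case False
        then have "q = p"
          using q by simp
        moreover have "\<forall>y\<in>R - ?b. (hd p, y) \<in> parcs ?G1 \<longleftrightarrow> y = last p"
          using rt3 by blast
        ultimately show ?thesis
          using IH hd_b q y by auto
      qed
    qed
  qed simp
  then show "executable ms G"
    and "\<And>x y. x \<in> R - bodies ps \<Longrightarrow> y \<in> R - bodies ps \<Longrightarrow>
           (x, y) \<in> parcs (measure_all ms G) \<longleftrightarrow> (x, y) \<in> parcs T"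
    and "\<And>h t y. h \<notin> R \<Longrightarrow> (\<And>y. y \<in> R \<Longrightarrow> (h, y) \<in> parcs G \<longleftrightarrow> y = t) \<Longrightarrow> t \<notin> bodies ps \<Longrightarrow>
           y \<in> R - bodies ps \<Longrightarrow> (h, y) \<in> parcs (measure_all ms G) \<longleftrightarrow> y = t"
    and "\<And>p y. p \<in> set ps \<Longrightarrow> last p \<notin> bodies ps \<Longrightarrow> y \<in> R - bodies ps \<Longrightarrow>
           (hd p, y) \<in> parcs (measure_all ms G) \<longleftrightarrow> y = last p"
    by blast+
qed

section \<open>Measuring every second vertex of a path\<close>

fun zigzag :: "'a list \<Rightarrow> ('a \<times> 'a) list" where
  "zigzag (a # b # c # p) = (b, a) # zigzag (c # p)"
| "zigzag p = []"

fun zigzag_rest :: "'a list \<Rightarrow> 'a list" where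
  "zigzag_rest (a # b # c # p) = zigzag_rest (c # p)"
| "zigzag_rest p = p"

text \<open>\<open>X_meas b a\<close> joins the neighbour \<open>x\<close> of \<open>a\<close> to
  the neighbour \<open>c\<close> of \<open>b\<close>. So \<open>x\<close> is again attached to the
  head of an induced path, now shorter by two; the basis \<open>a\<close> is left behind.\<close>

lemma zigzag:
  assumes "pair_graph G" "chordless G p" "x \<notin> set p"
    and "\<And>y. y \<in> set p \<Longrightarrow> (x, y) \<in> parcs G \<longleftrightarrow> y = hd p"
  defines "G' \<equiv> measure_all (X_measures (zigzag p)) G"
  shows "executable (X_measures (zigzag p)) G \<and> chordless G' (zigzag_rest p) \<and>
    (\<forall>y\<in>set (zigzag_rest p). (x, y) \<in> parcs G' \<longleftrightarrow> y = hd (zigzag_rest p))"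
  using assms(1-4) unfolding G'_def
proof (induction p arbitrary: G rule: zigzag.induct)
  case (1 a b c p)
  note G = 1(2)
  let ?G = "measure_vertex (X_meas b a) G"
  have G1: "pair_graph ?G"
    by (rule pair_graph_measure_vertex[OF G])
  have ba: "(b, a) \<in> parcs G"
    using "1.prems"(2) arc_sym[OF G, of a b] by simp
  have tail: "nbh ?G y = nbh G y" if "y \<in> set p" for y
    using nbh_measure_X_unchanged[OF G ba, of y] that "1.prems"(2) arc_sym[OF G, of y] by auto
  have pair: "(y, z) \<in> parcs ?G \<longleftrightarrow> (y, z) \<in> parcs G"
    if "y \<in> set (c # p)" "z \<in> set (c # p)" for y z
    using that arc_irrefl[OF G] arc_irrefl[OF G1] arc_eq_if_nbh_eq[OF G G1, of y z] tail by auto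
  have ch: "chordless ?G (c # p)"
    using "1.prems"(2) chordless_cong[of "c # p" ?G G] pair by simp
  have xc: "(x, y) \<in> parcs ?G \<longleftrightarrow> y = hd (c # p)" if "y \<in> set (c # p)" for y
  proof (cases "y = c")
    case True
    have "x \<noteq> a" "x \<noteq> b" "c \<noteq> a" "c \<noteq> b"
      using "1.prems"(2,3) by auto
    then show ?thesis
      using True arc_measure_X[OF G ba, of x c] "1.prems"(2,4) by auto
  next
    case False
    then have "y \<in> set p"
      using that by simp
    then have "(x, y) \<in> parcs ?G \<longleftrightarrow> (x, y) \<in> parcs G"
      using tail arc_eq_if_nbh_eq[OF G G1] by blast
    then show ?thesis
      using False "1.prems"(2) "1.prems"(4)[of y] \<open>y \<in> set p\<close> by auto
  qed
  show ?case
    using "1.IH"[OF G1 ch _ xc] "1.prems"(3) ba arc_in_pverts[OF G ba] by simp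
qed auto

lemma zigzag_rest:
  assumes "p \<noteq> []"
  shows "zigzag_rest p = (if even (length p) then [last (butlast p), last p] else [last p])"
  using assms by (induction p rule: zigzag_rest.induct) auto

text \<open>Up to the final one or two vertices, bases and measured vertices alternate along the
  path. Only \<open>last p\<close> may be a party, so every basis counts as consumed.\<close>

lemma consumed_zigzag:
  assumes "distinct p" "set (butlast p) \<inter> P = {}"
  shows "distinct (consumed P (zigzag p) @ zigzag_rest p)"
    and "set (consumed P (zigzag p) @ zigzag_rest p) = set p"
proof -
  have "distinct (consumed P (zigzag p) @ zigzag_rest p) \<and>
    set (consumed P (zigzag p) @ zigzag_rest p) = set p"
    using assms
  proof (induction p rule: zigzag.induct)
    case (1 a b c p)
    then have IH: "distinct (consumed P (zigzag (c # p)) @ zigzag_rest (c # p))"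
      "set (consumed P (zigzag (c # p)) @ zigzag_rest (c # p)) = set (c # p)"
      by (auto split: if_splits)
    moreover have "a \<notin> P" "a \<noteq> b" "a \<notin> set (c # p)" "b \<notin> set (c # p)"
      using 1 by auto
    ultimately show ?case
      unfolding consumed_def zigzag.simps zigzag_rest.simps by auto
  qed (auto simp: consumed_def)
  then show "distinct (consumed P (zigzag p) @ zigzag_rest p)"
    and "set (consumed P (zigzag p) @ zigzag_rest p) = set p"
    by auto
qed

lemma zigzag_eq_filter:
  assumes "distinct p" "p \<noteq> []"
  shows "map (\<lambda>s. X_meas (p ! (s - 1)) (p ! (s - 1 - 1)))
    (filter (\<lambda>s. even s \<and> p ! (s - 1) \<notin> {hd p, last p}) [1..<length p + 1]) = X_measures (zigzag p)"
proof -
  \<comment> \<open>An even position counted from 1 is never that of the head, so in a distinct list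
    the condition excludes just the last vertex.\<close>
  have "filter (\<lambda>s. even s \<and> p ! (s - 1) \<notin> {hd p, last p}) [1..<length p + 1]
      = filter (\<lambda>s. even s \<and> s < length p) [1..<length p + 1]"
    using assms nth_eq_iff_index_eq[OF assms(1)]
    by (intro filter_cong refl) (auto simp: hd_conv_nth last_conv_nth)
  moreover have "map (\<lambda>s. X_meas (p ! (s - 1)) (p ! (s - 1 - 1)))
    (filter (\<lambda>s. even s \<and> s < length p) [1..<length p + 1]) = X_measures (zigzag p)"
    using assms(2)
  proof (induction p rule: zigzag.induct)
    case (1 a b c p)
    let ?p = "c # p"
    have upt: "[1..<length (a # b # c # p) + 1] = [1, 2] @ map (\<lambda>s. s + 2) [1..<length ?p + 1]"
      by (simp add: upt_conv_Cons map_Suc_upt flip: map_map [of Suc Suc, unfolded comp_def] del: upt_Suc)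
    let ?F = "filter (\<lambda>s. even s \<and> s < length ?p) [1..<length ?p + 1]"
    let ?X = "\<lambda>p s. X_meas (p ! (s - 1)) (p ! (s - 1 - 1))"
    have shift: "map (\<lambda>s. ?X (a # b # ?p) (s + 2)) ?F = map (?X ?p) ?F"
    proof (rule map_cong[OF refl])
      fix s assume "s \<in> set ?F"
      then have "even s" "1 \<le> s"
        by auto
      \<comment> \<open>An even positive \<open>s\<close> is at least 2, so \<open>s - 1 - 1\<close>
        does not truncate and the shift by two vertices is exact.\<close>
      then obtain k where "s = Suc (Suc k)"
        by (metis One_nat_def not0_implies_Suc not_less_eq_eq odd_one le_zero_eq nat.distinct(1))
      then show "?X (a # b # ?p) (s + 2) = ?X ?p s"
        by simp
    qed
    have "filter (\<lambda>s. even s \<and> s < length (a # b # ?p)) [1..<length (a # b # ?p) + 1]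
        = 2 # map (\<lambda>s. s + 2) ?F"
      unfolding upt by (simp add: filter_map comp_def del: upt_Suc)
    then have "map (?X (a # b # ?p)) (filter (\<lambda>s. even s \<and> s < length (a # b # ?p))
        [1..<length (a # b # ?p) + 1]) = X_meas b a # map (\<lambda>s. ?X (a # b # ?p) (s + 2)) ?F"
      by (simp only: list.map map_map comp_def) simp
    also have "\<dots> = X_meas b a # X_measures (zigzag ?p)"
      unfolding shift using "1.IH" by simp
    finally show ?case
      by simp
  qed auto
  ultimately show ?thesis
    by simp
qed

section \<open>Routes and the vertices they consume\<close>

lemma set_butlast_last:
  assumes "distinct p" "p \<noteq> []"
  shows "set p = insert (last p) (set (butlast p))" "last p \<notin> set (butlast p)"
  using assms by (induction p) auto

lemma arg_min_on_eq:
  fixes f :: "'a \<Rightarrow> nat"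
  assumes "finite S" "x \<in> S" "\<And>y. y \<in> S \<Longrightarrow> y \<noteq> x \<Longrightarrow> f x < f y"
  shows "arg_min_on f S = x"
  using arg_min_if_finite[OF assms(1), of f] assms(2,3) by (metis empty_iff)

text \<open>Makes routability checkable for a list whose order is known only in part: at each
  splitting point the bodies before it are all that \<open>R\<close> has lost.\<close>

lemma routableI:
  assumes "\<And>p. p \<in> set ps \<Longrightarrow> chordless T p \<and> 2 \<le> length p \<and> set p \<subseteq> R"
    and "\<And>ps1 p ps2. ps = ps1 @ p # ps2 \<Longrightarrow> set p \<inter> bodies ps1 = {}"
    and "\<And>ps1 p ps2 x y. ps = ps1 @ p # ps2 \<Longrightarrow> x \<in> set (butlast p) \<Longrightarrow> y \<in> R - bodies ps1 \<Longrightarrow>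
      (x, y) \<in> parcs T \<Longrightarrow> y \<in> set p"
  shows "routable T R ps"
  using assms
proof (induction ps arbitrary: R)
  case (Cons p ps)
  have "routable T (R - set (butlast p)) ps"
  proof (rule Cons.IH)
    fix q assume q: "q \<in> set ps"
    then obtain ps1 ps2 where "ps = ps1 @ q # ps2"
      by (meson split_list)
    then have "set q \<inter> bodies (p # ps1) = {}"
      by (intro Cons.prems(2)[of "p # ps1" q ps2]) simp
    then show "chordless T q \<and> 2 \<le> length q \<and> set q \<subseteq> R - set (butlast p)"
      using Cons.prems(1)[of q] q by auto
  next
    fix ps1 q ps2 assume "ps = ps1 @ q # ps2"
    then show "set q \<inter> bodies ps1 = {}"
      using Cons.prems(2)[of "p # ps1" q ps2] by auto
  next
    fix ps1 q ps2 x y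
    assume "ps = ps1 @ q # ps2" "x \<in> set (butlast q)" "y \<in> R - set (butlast p) - bodies ps1"
      "(x, y) \<in> parcs T"
    then show "y \<in> set q"
      using Cons.prems(3)[of "p # ps1" q ps2 x y] by auto
  qed
  then show ?case
    using Cons.prems(1)[of p] Cons.prems(3)[of "[]" p ps] by auto
qed simp

lemma routable_bodies: "routable T R ps \<Longrightarrow> bodies ps \<subseteq> R"
  by (induction ps arbitrary: R) (auto dest: in_set_butlastD)

lemma consumed_append:
  "set (consumed P (vws @ vws')) = set (consumed P vws) \<union> set (consumed P vws')"
  "distinct (consumed P (vws @ vws')) \<longleftrightarrow> distinct (consumed P vws) \<and> distinct (consumed P vws') \<and>
     set (consumed P vws) \<inter> set (consumed P vws') = {}"
  unfolding consumed_def by auto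

lemma set_interior: "distinct p \<Longrightarrow> set (interior p) = set (butlast p) - {hd p}"
  unfolding interior_def by (cases p) (auto dest: in_set_butlastD)

text \<open>The bases are the heads, all of them parties, so a route consumes just its interior.
  Nothing is consumed twice, as the bodies of a routable list are disjoint.\<close>

lemma consumed_routes:
  assumes "routable T R ps" "\<And>p. p \<in> set ps \<Longrightarrow> hd p \<in> P \<and> set (interior p) \<inter> P = {}"
  shows "distinct (consumed P (concat (map route_pairs ps)))"
    and "set (consumed P (concat (map route_pairs ps))) = bodies ps - P"
proof -
  have "distinct (consumed P (concat (map route_pairs ps))) \<and>
    set (consumed P (concat (map route_pairs ps))) = bodies ps - P"
    using assms
  proof (induction ps arbitrary: R)
    case (Cons p ps)
    have IH: "distinct (consumed P (concat (map route_pairs ps)))"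
      "set (consumed P (concat (map route_pairs ps))) = bodies ps - P"
      using Cons.IH[of "R - set (butlast p)"] Cons.prems by auto
    have p: "hd p \<in> P" "set (interior p) \<inter> P = {}" "distinct p"
      using Cons.prems chordless_distinct[of T p] by auto
    have c: "consumed P (route_pairs p) = interior p"
      using p(1) by (auto simp: consumed_def comp_def)
    have "distinct (interior p)"
      using p(3) by (simp add: interior_def distinct_butlast distinct_tl)
    moreover have "set (interior p) = set (butlast p) - P"
      using set_interior[OF p(3)] p by auto
    moreover have "bodies ps \<inter> set (butlast p) = {}"
      using routable_bodies[of T "R - set (butlast p)" ps] Cons.prems(1) by auto
    ultimately show ?case
      using IH c by (auto simp: consumed_append)
  qed (simp add: consumed_def)
  then show "distinct (consumed P (concat (map route_pairs ps)))"
    and "set (consumed P (concat (map route_pairs ps))) = bodies ps - P"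
    by auto
qed

text \<open>\<open>i\<close> is a party attached to \<open>s\<close> only at \<open>c\<close>; the
  zigzag on a path with an odd number of vertices carries it to \<open>r\<close>. For an even number
  it carries the chosen basis \<open>x\<close> to the penultimate vertex \<open>z\<close>, and
  measuring \<open>z\<close> hands \<open>x\<close> the arc to \<open>r\<close>. The protocol allows
  for \<open>x\<close> any party adjacent to \<open>c\<close>, hence \<open>nbhs\<close>, whose
  second alternative covers a root that is itself a party next to \<open>c\<close>.\<close>

lemma connect_to_root:
  assumes G: "pair_graph G" and s: "chordless G s" "tree_path T c r = s" "hd s = c" "last s = r"
      "2 \<le> length s" "set (butlast s) \<inter> P = {}"
    and i: "i \<in> P" "i \<notin> set s" "\<And>y. y \<in> set s \<Longrightarrow> (i, y) \<in> parcs G \<longleftrightarrow> y = c"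
    and nbhs: "\<And>x. x \<in> P \<Longrightarrow> (c, x) \<in> parcs G \<Longrightarrow>
      (x \<notin> set s \<and> (\<forall>y\<in>set s. (x, y) \<in> parcs G \<longleftrightarrow> y = c)) \<or> (x = r \<and> length s = 2)"
    and ms: "connect_to_root T r P G c ms"
  shows "\<exists>vws. ms = X_measures vws \<and> executable ms G \<and> distinct (consumed P vws) \<and>
    set (consumed P vws) = set (butlast s) \<and>
    (r \<notin> P \<longrightarrow> (\<exists>x\<in>P. (x, r) \<in> parcs (measure_all ms G)))"
proof -
  have ne: "s \<noteq> []" and dist: "distinct s"
    using s(5) chordless_distinct[OF s(1)] by auto
  have xs: "map (\<lambda>n. X_meas (s ! (n - 1)) (s ! (n - 1 - 1)))
    (filter (\<lambda>n. even n \<and> s ! (n - 1) \<notin> {c, r}) [1..<length s + 1]) = X_measures (zigzag s)"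
    using zigzag_eq_filter[OF dist ne] s(3,4) by simp
  note set_s = set_butlast_last[OF dist ne, unfolded s(4)]
  let ?G = "measure_all (X_measures (zigzag s)) G"
  have G': "pair_graph ?G"
    by (rule pair_graph_measure_all[OF G])
  note con = consumed_zigzag[OF dist s(6)]
  show ?thesis
  proof (cases "even (length s)")
    case False
    then have msx: "ms = X_measures (zigzag s)"
      using ms xs unfolding connect_to_root_def s(2) Let_def by simp
    have rest: "zigzag_rest s = [r]"
      using zigzag_rest[OF ne] False s(4) by simp
    have "executable ms G" "(i, r) \<in> parcs ?G"
      using zigzag[OF G s(1) i(2), unfolded s(3), OF i(3)] rest msx by auto
    moreover have "distinct (consumed P (zigzag s))" "set (consumed P (zigzag s)) = set (butlast s)"
      using con set_s unfolding rest by auto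
    ultimately show ?thesis
      using i(1) msx by blast
  next
    case True
    define z where "z = last (butlast s)"
    have z: "s ! (length s - 1 - 1) = z"
      using s(5) by (simp add: z_def last_conv_nth nth_butlast flip: length_greater_0_conv)
    obtain x where x: "x \<in> P" "(c, x) \<in> parcs G" "ms = X_measures (zigzag s) @ [X_meas z x]"
      using ms xs True z unfolding connect_to_root_def s(2) Let_def by auto
    have rest: "zigzag_rest s = [z, r]"
      using zigzag_rest[OF ne] True s(4) by (simp add: z_def)
    have main: "executable (X_measures (zigzag s)) G \<and> (z, x) \<in> parcs ?G \<and>
      (r \<notin> P \<longrightarrow> (z, r) \<in> parcs ?G)"
    \<comment> \<open>If \<open>s\<close> is just \<open>c, r\<close> and \<open>x\<close> is the
      root, then the zigzag is empty, \<open>z\<close> is \<open>c\<close>, and the claim about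
      \<open>r\<close> is void because \<open>r\<close> is a party.\<close>
    proof (cases "x = r \<and> length s = 2")
      case True
      then have "s = [z, r]"
        using rest by (cases s rule: zigzag_rest.cases) auto
      then show ?thesis
        using x(1,2) True s(3) by auto
    next
      case False
      then have x': "x \<notin> set s" "\<And>y. y \<in> set s \<Longrightarrow> (x, y) \<in> parcs G \<longleftrightarrow> y = hd s"
        using nbhs[OF x(1,2)] s(3) by blast+
      show ?thesis
        using zigzag[OF G s(1) x'] arc_sym[OF G', of z x] by (simp add: rest)
    qed
    then have zx: "(z, x) \<in> parcs ?G"
      by blast
    have exec: "executable ms G"
      using main arc_in_pverts[OF G' zx] by (simp add: x(3))
    have "(x, r) \<in> parcs (measure_all ms G)" if "r \<notin> P"
      using arc_measure_X_basis[OF G' zx, of r] main that x(1) by (auto simp: x(3))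
    moreover have "distinct (consumed P (zigzag s @ [(z, x)]))"
      "set (consumed P (zigzag s @ [(z, x)])) = set (butlast s)"
      using con set_s x(1) unfolding rest by (auto simp: consumed_append consumed_def)
    ultimately show ?thesis
      using x(1,3) exec by (intro exI[of _ "zigzag s @ [(z, x)]"]) auto
  qed
qed


section \<open>Trees\<close>

lemma arg_max_on_finite:
  fixes f :: "'a \<Rightarrow> nat"
  assumes "finite S" "S \<noteq> {}"
  shows "arg_max_on f S \<in> S" and "\<And>x. x \<in> S \<Longrightarrow> f x \<le> f (arg_max_on f S)"
proof -
  obtain k where "k \<in> S"
    using assms(2) by blast
  \<comment> \<open>\<open>arg_max_nat_lemma\<close> asks for a strict bound, hence the successor of
    the maximum.\<close>
  moreover have "\<forall>y. y \<in> S \<longrightarrow> f y < Suc (Max (f ` S))"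
    using assms(1) by (simp add: le_imp_less_Suc)
  ultimately have "arg_max_on f S \<in> S \<and> (\<forall>y. y \<in> S \<longrightarrow> f y \<le> f (arg_max_on f S))"
    unfolding arg_max_on_def by (rule arg_max_nat_lemma)
  then show "arg_max_on f S \<in> S" "\<And>x. x \<in> S \<Longrightarrow> f x \<le> f (arg_max_on f S)"
    by blast+
qed

lemma vpath_iff:
  "vpath p (with_proj G) \<longleftrightarrow>
     p \<noteq> [] \<and> set p \<subseteq> pverts G \<and> successively (\<lambda>x y. (x, y) \<in> parcs G) p \<and> distinct p"
proof -
  have "set (vwalk_arcs p) \<subseteq> parcs G \<longleftrightarrow> successively (\<lambda>x y. (x, y) \<in> parcs G) p"
    by (induction p rule: vwalk_arcs.induct) auto
  then show ?thesis
    by (auto simp: vpath_def vwalk_def)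
qed

locale tree_graph =
  fixes T :: "'a pair_pre_digraph"
  assumes undirected_tree: "undirected_tree T"
begin

abbreviation "path p \<equiv> vpath p (with_proj T)"

lemma pair_graph_T: "pair_graph T"
  using undirected_tree by (simp add: undirected_tree_def)

lemma finite_pverts: "finite (pverts T)"
  using pair_graph_T by (simp add: pair_graph_iff)

lemmas arc_symT = arc_sym[OF pair_graph_T]
lemmas arc_irreflT = arc_irrefl[OF pair_graph_T]
lemmas arc_in_pvertsT = arc_in_pverts[OF pair_graph_T]

lemma no_cycle: "path p \<Longrightarrow> (last p, hd p) \<in> parcs T \<Longrightarrow> length p < 3"
  using undirected_tree unfolding undirected_tree_def by (meson not_le)

lemma path_nonempty: "path p \<Longrightarrow> p \<noteq> []"
  and path_distinct: "path p \<Longrightarrow> distinct p"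
  and path_pverts: "path p \<Longrightarrow> set p \<subseteq> pverts T"
  by (auto simp: vpath_iff)

lemma path_rev: "path p \<Longrightarrow> path (rev p)"
  unfolding vpath_iff using arc_symT by (auto elim: successively_mono)

lemma path_suffix: "path (p @ q) \<Longrightarrow> q \<noteq> [] \<Longrightarrow> path q"
  and path_prefix: "path (p @ q) \<Longrightarrow> p \<noteq> [] \<Longrightarrow> path p"
  by (auto simp: vpath_iff successively_append_iff)

lemma path_snoc: "path p \<Longrightarrow> (last p, x) \<in> parcs T \<Longrightarrow> x \<notin> set p \<Longrightarrow> path (p @ [x])"
  using arc_in_pvertsT by (auto simp: vpath_iff successively_append_iff)

text \<open>The segment from \<open>x\<close> to the end closes up to a cycle unless it has only two
  vertices. Together with \<open>path_snoc\<close> this gives the dichotomy behind the later tree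
  arguments: a neighbour of the end either extends the path or precedes the end.\<close>

lemma path_end_neighbour:
  assumes "path p" "(last p, x) \<in> parcs T" "x \<in> set p"
  shows "\<exists>p'. p = p' @ [x, last p]"
proof -
  obtain a b where p: "p = a @ x # b"
    using assms(3) by (meson split_list)
  have "b \<noteq> []"
    using assms(2) arc_irreflT by (auto simp: p)
  moreover have "length (x # b) < 3"
    using no_cycle[of "x # b"] path_suffix[of a "x # b"] assms(1,2) \<open>b \<noteq> []\<close> by (simp add: p)
  ultimately obtain y where "b = [y]"
    by (cases b) auto
  then show ?thesis
    by (simp add: p)
qed

text \<open>Both paths are compared at the vertex before the end \<open>x\<close> of the second one,
  \<open>last q\<close>. If it lies on \<open>p\<close>, it precedes \<open>x\<close> there too, and
  both paths can be shortened. If not, \<open>p\<close> extended by it equals \<open>q\<close> by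
  induction, although \<open>q\<close> avoids \<open>x\<close>.\<close>

lemma path_unique:
  assumes "path p" "path q" "hd p = hd q" "last p = last q"
  shows "p = q"
  using assms
proof (induction q arbitrary: p rule: rev_induct)
  case Nil
  then show ?case
    by (simp add: vpath_iff)
next
  case (snoc x q)
  show ?case
  proof (cases "q = []")
    case True
    then have "hd p = x" "last p = x"
      using snoc.prems by auto
    then show ?thesis
      using path_nonempty[OF snoc.prems(1)] path_distinct[OF snoc.prems(1)] True
      by (cases p) (auto split: if_splits)
  next
    case False
    then have q: "path q" "(last q, x) \<in> parcs T" "x \<notin> set q"
      using snoc.prems(2) by (auto simp: vpath_iff successively_append_iff)
    have px: "last p = x" "hd p = hd q"
      using snoc.prems False by auto
    show ?thesis
    proof (cases "last q \<in> set p")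
      case True
      then obtain p' where p': "p = p' @ [last q, x]"
        using path_end_neighbour[OF snoc.prems(1), of "last q"] px q(2) arc_symT by auto
      then have "path (p' @ [last q])"
        using path_prefix[of "p' @ [last q]" "[x]"] snoc.prems(1) by simp
      moreover have "hd (p' @ [last q]) = hd q"
        using px(2) p' by (cases p') auto
      ultimately show ?thesis
        using snoc.IH[of "p' @ [last q]"] q(1) p' by simp
    next
      case notin: False
      then have "path (p @ [last q])"
        using path_snoc[OF snoc.prems(1), of "last q"] px q(2) arc_symT by auto
      then have "p @ [last q] = q"
        using snoc.IH[of "p @ [last q]"] q(1) px path_nonempty[OF snoc.prems(1)] by simp
      then show ?thesis
        using q(3) px path_nonempty[OF snoc.prems(1)] by (metis UnCI last_in_set set_append)
    qed
  qed
qed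

lemma path_exists:
  assumes "u \<in> pverts T" "v \<in> pverts T"
  shows "\<exists>p. path p \<and> hd p = u \<and> last p = v"
proof -
  interpret pair_graph T
    by (rule pair_graph_T)
  \<comment> \<open>Connectedness is defined through the symmetric closure, which adds nothing to
    the symmetric \<open>T\<close>.\<close>
  have "Digraph_Component.connected (with_proj T)"
    using undirected_tree by (simp add: undirected_tree_def)
  then have "u \<rightarrow>\<^sup>*\<^bsub>mk_symmetric (with_proj T)\<^esub> v"
    using assms by (simp add: connected_def strongly_connected_def)
  then have "u \<rightarrow>\<^sup>*\<^bsub>with_proj T\<^esub> v"
    using reachable_mk_symmetric_eq[OF pair_sym_arcs] by simp
  then show ?thesis
    by (simp add: reachable_vpath_conv)
qed

lemma tree_path:
  assumes "u \<in> pverts T" "v \<in> pverts T"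
  shows path_tree_path: "path (tree_path T u v)"
    and hd_tree_path: "hd (tree_path T u v) = u"
    and last_tree_path: "last (tree_path T u v) = v"
    and tree_path_nonempty: "tree_path T u v \<noteq> []"
proof -
  obtain p where p: "path p \<and> hd p = u \<and> last p = v"
    using path_exists[OF assms] by blast
  then have "path (tree_path T u v) \<and> hd (tree_path T u v) = u \<and> last (tree_path T u v) = v"
    unfolding tree_path_def by (rule theI) (use p path_unique[of _ p] in auto)
  then show "path (tree_path T u v)" "hd (tree_path T u v) = u" "last (tree_path T u v) = v"
    "tree_path T u v \<noteq> []"
    by (auto dest: path_nonempty)
qed

lemma tree_path_eq: "path p \<Longrightarrow> hd p = u \<Longrightarrow> last p = v \<Longrightarrow> tree_path T u v = p"
proof -
  assume p: "path p" "hd p = u" "last p = v"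
  then have "u \<in> pverts T" "v \<in> pverts T"
    using path_pverts[OF p(1)] path_nonempty[OF p(1)] hd_in_set[of p] last_in_set[of p] by auto
  then show "tree_path T u v = p"
    using path_unique[OF path_tree_path p(1)] p hd_tree_path last_tree_path by simp
qed

lemma tree_path_rev:
  assumes "u \<in> pverts T" "v \<in> pverts T"
  shows "tree_path T v u = rev (tree_path T u v)"
  using tree_path[OF assms] by (intro tree_path_eq path_rev) (simp_all add: hd_rev last_rev)

lemma tree_path_refl: "u \<in> pverts T \<Longrightarrow> tree_path T u u = [u]"
  by (rule tree_path_eq) (simp_all add: vpath_iff)

lemma tree_path_split:
  assumes "tree_path T u v = a @ x # b" "u \<in> pverts T" "v \<in> pverts T"
  shows "tree_path T u x = a @ [x]" "tree_path T x v = x # b"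
proof -
  note p = tree_path[OF assms(2,3), unfolded assms(1)]
  show "tree_path T u x = a @ [x]"
    using p path_prefix[of "a @ [x]" b] by (intro tree_path_eq) (auto simp: hd_append)
  show "tree_path T x v = x # b"
    using p path_suffix[of a "x # b"] by (intro tree_path_eq) auto
qed

lemma tree_path_suffix_subset:
  assumes "x \<in> set (tree_path T u v)" "u \<in> pverts T" "v \<in> pverts T"
  shows "set (tree_path T x v) \<subseteq> set (tree_path T u v)"
proof -
  obtain a b where "tree_path T u v = a @ x # b"
    using assms(1) by (meson split_list)
  with tree_path_split(2)[OF this assms(2,3)] show ?thesis
    by auto
qed

text \<open>A chord from the head would close a cycle: this is \<open>path_end_neighbour\<close> for
  the reversed path.\<close>

lemma chordless_path: "path p \<Longrightarrow> chordless T p"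
proof (induction p)
  case (Cons x p)
  have "(x, y) \<in> parcs T \<longleftrightarrow> y = hd p" if y: "y \<in> set p" for y
  proof
    assume "(x, y) \<in> parcs T"
    then obtain p' where "rev (x # p) = p' @ [y, x]"
      using path_end_neighbour[OF path_rev[OF Cons.prems], of y] y by auto
    then have "x # p = x # y # rev p'"
      by (metis append.simps rev.simps rev_append rev_rev_ident append_assoc)
    then show "y = hd p"
      by simp
  next
    assume "y = hd p"
    then show "(x, y) \<in> parcs T"
      using Cons.prems y by (cases p) (auto simp: vpath_iff)
  qed
  moreover have "chordless T p"
    using Cons.IH path_suffix[of "[x]" p] Cons.prems by (cases "p = []") auto
  ultimately show ?case
    using path_distinct[OF Cons.prems] by simp
qed simp

lemma chordless_append_arc:
  "chordless T (p @ q) \<Longrightarrow> x \<in> set p \<Longrightarrow> y \<in> set q \<Longrightarrow> (x, y) \<in> parcs T \<Longrightarrow> y = hd q"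
proof (induction p)
  case (Cons z p)
  have "distinct (p @ q)"
    using chordless_distinct[of T "p @ q"] Cons.prems(1) by simp
  then have "hd p \<notin> set q" if "p \<noteq> []"
    using that by (meson disjoint_iff distinct_append hd_in_set)
  with Cons show ?case
    by (auto simp: hd_append split: if_splits)
qed simp

text \<open>
  A vertex \<open>s\<close> of \<open>S\<close> farthest from \<open>q\<close> has a neighbour in \<open>Q\<close> that is even farther from \<open>q\<close>, and
  no other vertex of \<open>S\<close> is adjacent to it.
\<close>

lemma nondeg_unit:
  assumes Q: "P \<subseteq> Q" "Q \<subseteq> pverts T" "q \<in> Q"
    and two: "\<And>s. s \<in> Q - P \<Longrightarrow> \<exists>a\<in>Q. \<exists>b\<in>Q. a \<noteq> b \<and> (s, a) \<in> parcs T \<and> (s, b) \<in> parcs T"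
  shows "nondeg T P (Q - P) (\<lambda>x. of_bool (x = q))"
  unfolding nondeg_def
proof (intro allI impI)
  fix S assume S: "S \<subseteq> Q - P"
  show "\<exists>x\<in>P \<union> (Q - P). of_bool (x = q) + (\<Sum>s\<in>S. adj T s x) \<noteq> 0"
  proof (cases "S = {}")
    case True
    then show ?thesis
      using Q by auto
  next
    case False
    have fin: "finite S"
      using S Q(2) finite_pverts by (meson Diff_subset finite_subset)
    let ?d = "\<lambda>s. length (tree_path T q s)"
    define s where "s = arg_max_on ?d S"
    have s: "s \<in> S" and max: "\<And>s'. s' \<in> S \<Longrightarrow> ?d s' \<le> ?d s"
      unfolding s_def by (rule arg_max_on_finite[OF fin False], assumption?)+
    have V: "q \<in> pverts T" "s \<in> pverts T"
      using Q S s by auto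
    note p = tree_path[OF V]
    let ?p = "tree_path T q s"
    obtain a b where ab: "a \<in> Q" "b \<in> Q" "a \<noteq> b" "(s, a) \<in> parcs T" "(s, b) \<in> parcs T"
      using two[of s] s S by blast
    \<comment> \<open>A neighbour of \<open>s\<close> on the path is its penultimate vertex, so at
      most one of \<open>a\<close> and \<open>b\<close> lies on it.\<close>
    have "a \<notin> set ?p \<or> b \<notin> set ?p"
    proof (rule ccontr)
      assume "\<not> ?thesis"
      then have "\<exists>p'. ?p = p' @ [a, s]" "\<exists>p'. ?p = p' @ [b, s]"
        using path_end_neighbour[OF p(1), of a] path_end_neighbour[OF p(1), of b] ab
        unfolding p(3) by blast+
      then obtain p1 p2 where "?p = p1 @ [a, s]" "?p = p2 @ [b, s]"
        by blast
      then have "p1 @ [a, s] = p2 @ [b, s]"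
        by metis
      then show False
        using ab(3) by simp
    qed
    then obtain x where x: "x \<in> Q" "(s, x) \<in> parcs T" "x \<notin> set ?p"
      using ab by blast
    have px: "path (?p @ [x])"
      using path_snoc[OF p(1)] p(3) x by simp
    \<comment> \<open>A second neighbour of \<open>x\<close> in \<open>S\<close>, off the path,
      would be farther from \<open>q\<close> than \<open>s\<close>, against the choice of
      \<open>s\<close>.\<close>
    have only: "s' = s" if s': "s' \<in> S" "(s', x) \<in> parcs T" for s'
    proof (cases "s' \<in> set (?p @ [x])")
      case True
      then obtain p' where p': "?p @ [x] = p' @ [s', x]"
        using path_end_neighbour[OF px, of s'] s'(2) arc_symT by auto
      then have "?p = p' @ [s']"
        by simp
      then show ?thesis
        using p(3) by simp
    next
      case False
      then have "path ((?p @ [x]) @ [s'])"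
        using path_snoc[OF px, of s'] s'(2) arc_symT by auto
      then have "tree_path T q s' = (?p @ [x]) @ [s']"
        by (rule tree_path_eq) (use p in auto)
      then show ?thesis
        using max[OF s'(1)] by simp
    qed
    have "adj T s' x = of_bool (s' = s)" if "s' \<in> S" for s'
    proof (cases "s' = s")
      case False
      then have "(s', x) \<notin> parcs T"
        using only[OF that] by blast
      with False show ?thesis
        by (simp add: adj_def)
    qed (use x(2) in \<open>simp add: adj_def\<close>)
    then have "(\<Sum>s'\<in>S. adj T s' x) = (\<Sum>s'\<in>S. of_bool (s' = s))"
      by simp
    also have "\<dots> = 1"
      using fin s by (simp add: of_bool_def)
    finally have "(\<Sum>s'\<in>S. adj T s' x) = 1" .
    moreover have "x \<noteq> q"
      using x(3) p hd_in_set[of ?p] by auto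
    ultimately have "of_bool (x = q) + (\<Sum>s\<in>S. adj T s x) \<noteq> 0"
      by simp
    then show ?thesis
      using x(1) by blast
  qed
qed

text \<open>A second common vertex of the new root paths would lie before \<open>r\<close> on every
  path to \<open>r0\<close>, hence be a common vertex farther from \<open>r0\<close> than
  \<open>r\<close>. The structure of the spanned subtree rests on this property.\<close>

lemma new_root:
  assumes "r0 \<in> pverts T" "P \<subseteq> pverts T" "P \<noteq> {}"
  defines "r \<equiv> new_root T r0 P"
  shows "r \<in> pverts T" and "(\<Inter>i\<in>P. set (tree_path T i r)) = {r}"
proof -
  define C where "C = (\<Inter>i\<in>P. set (tree_path T i r0))"
  have PV: "i \<in> pverts T" if "i \<in> P" for i
    using assms(2) that by blast
  have r0C: "r0 \<in> C"
    using tree_path[OF PV assms(1)] unfolding C_def by (metis INT_I last_in_set)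
  obtain i0 where i0: "i0 \<in> P"
    using assms(3) by blast
  have CV: "C \<subseteq> pverts T"
    using i0 path_pverts[OF path_tree_path[OF PV[OF i0] assms(1)]] unfolding C_def by blast
  then have fin: "finite (C - {r0})"
    using finite_pverts finite_subset by blast
  have r: "r = (if C - {r0} = {} then r0 else arg_max_on (tree_dist T r0) (C - {r0}))"
    unfolding r_def new_root_def C_def by simp
  \<comment> \<open>When the default applies, \<open>r0\<close> is the only vertex of
    \<open>C\<close>; otherwise its distance 0 is no competition. Both branches thus give a farthest
    vertex of \<open>C\<close>.\<close>
  have "r \<in> C \<and> (\<forall>x\<in>C. tree_dist T r0 x \<le> tree_dist T r0 r)"
  proof (cases "C - {r0} = {}")
    case True
    then have "C = {r0}" "r = r0"
      using r0C r by auto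
    then show ?thesis
      by simp
  next
    case False
    have "tree_dist T r0 r0 = 0"
      by (simp add: tree_dist_def tree_path_refl[OF assms(1)])
    then show ?thesis
      using False r arg_max_on_finite[OF fin False, where f = "tree_dist T r0"]
      by (metis DiffD1 DiffI le0 singletonD)
  qed
  then have rC: "r \<in> C" and max: "\<And>x. x \<in> C \<Longrightarrow> tree_dist T r0 x \<le> tree_dist T r0 r"
    by blast+
  show rV: "r \<in> pverts T"
    using rC CV by blast
  show "(\<Inter>i\<in>P. set (tree_path T i r)) = {r}"
  proof
    show "{r} \<subseteq> (\<Inter>i\<in>P. set (tree_path T i r))"
      using last_tree_path[OF PV rV] tree_path_nonempty[OF PV rV] last_in_set by fastforce
    show "(\<Inter>i\<in>P. set (tree_path T i r)) \<subseteq> {r}"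
    proof (rule ccontr)
      assume "\<not> ?thesis"
      then obtain x where x: "\<And>i. i \<in> P \<Longrightarrow> x \<in> set (tree_path T i r)" "x \<noteq> r"
        by blast
      have split: "\<exists>a b. tree_path T i r0 = a @ r # b \<and> tree_path T i r = a @ [r]" if i: "i \<in> P" for i
      proof -
        have "r \<in> set (tree_path T i r0)"
          using rC i unfolding C_def by blast
        then obtain a b where ab: "tree_path T i r0 = a @ r # b"
          by (meson split_list)
        show ?thesis
          using ab tree_path_split(1)[OF ab PV[OF i] assms(1)] by blast
      qed
      have "x \<in> C"
        unfolding C_def
      proof
        fix i assume i: "i \<in> P"
        obtain a b where "tree_path T i r0 = a @ r # b" "tree_path T i r = a @ [r]"
          using split[OF i] by blast
        then show "x \<in> set (tree_path T i r0)"
          using x(1)[OF i] by auto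
      qed
      obtain a b where ab: "tree_path T i0 r0 = a @ r # b" "tree_path T i0 r = a @ [r]"
        using split[OF i0] by blast
      then have "x \<in> set a"
        using x(1)[OF i0] x(2) by simp
      then obtain a1 a2 where a: "a = a1 @ x # a2"
        by (meson split_list)
      have "tree_path T x r0 = x # a2 @ r # b" "tree_path T r r0 = r # b"
        using tree_path_split(2)[of i0 r0 a1 x "a2 @ r # b"] tree_path_split(2)[of i0 r0 a r b]
          ab(1) PV[OF i0] assms(1) by (simp_all add: a)
      moreover have "x \<in> pverts T"
        using CV \<open>x \<in> C\<close> by blast
      ultimately have "tree_dist T r0 r < tree_dist T r0 x"
        using tree_path_rev[OF _ assms(1)] rV by (simp add: tree_dist_def)
      then show False
        using max[OF \<open>x \<in> C\<close>] by simp
    qed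
  qed
qed

end


section \<open>The subtree spanned by the parties\<close>

locale rooted_parties = tree_graph T for T :: "'a pair_pre_digraph" +
  fixes r :: 'a and P :: "'a set"
  assumes root: "r \<in> pverts T" and parties: "P \<subseteq> pverts T" "2 \<le> card P" "card P \<le> 3"
    and root_paths_meet: "(\<Inter>i\<in>P. set (tree_path T i r)) = {r}"
begin

abbreviation "root_path i \<equiv> tree_path T i r"
text \<open>Two parties reach \<open>r\<close> along otherwise disjoint paths, so \<open>r\<close>
  belongs to the subtree spanned by the parties, and the union of the root paths is that
  subtree.\<close>

abbreviation "Q \<equiv> \<Union>i\<in>P. set (root_path i)"

lemma finite_P: "finite P"
  using parties(2) card.infinite by fastforce

lemma party_pverts: "i \<in> P \<Longrightarrow> i \<in> pverts T"
  using parties(1) by blast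

lemma root_path:
  assumes "i \<in> P"
  shows "path (root_path i)" "hd (root_path i) = i" "last (root_path i) = r" "root_path i \<noteq> []"
    "i \<in> set (root_path i)" "r \<in> set (root_path i)"
proof -
  note p = tree_path[OF party_pverts[OF assms] root]
  show "path (root_path i)" "hd (root_path i) = i" "last (root_path i) = r" "root_path i \<noteq> []"
    "i \<in> set (root_path i)" "r \<in> set (root_path i)"
    using p hd_in_set[OF p(4)] last_in_set[OF p(4)] by simp_all
qed

lemma Q_pverts: "Q \<subseteq> pverts T"
  using path_pverts root_path(1) by blast

lemma finite_Q: "finite Q"
  using Q_pverts finite_pverts finite_subset by blast

lemma P_subset_Q: "P \<subseteq> Q"
  using root_path(5) by blast

lemma party_exists: "\<exists>i. i \<in> P"
proof -
  have "P \<noteq> {}"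
    using parties(2) by auto
  then show ?thesis
    by blast
qed

lemma r_in_Q: "r \<in> Q"
  using party_exists root_path(6) by blast

lemma root_path_suffix: "x \<in> set (root_path i) \<Longrightarrow> i \<in> P \<Longrightarrow> set (root_path x) \<subseteq> set (root_path i)"
  using tree_path_suffix_subset root party_pverts by blast

lemma root_path_subset_Q: "x \<in> Q \<Longrightarrow> set (root_path x) \<subseteq> Q"
  using root_path_suffix by blast

lemma root_path_length: "i \<in> P \<Longrightarrow> i \<noteq> r \<Longrightarrow> 2 \<le> length (root_path i)"
  using root_path[of i] by (cases "root_path i"; cases "tl (root_path i)") auto

text \<open>Of two adjacent vertices one is the parent of the other, and every root path through the
  child passes through the parent.\<close>

lemma common_root_path:
  assumes "x \<in> Q" "y \<in> Q" "(x, y) \<in> parcs T"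
  shows "\<exists>l\<in>P. x \<in> set (root_path l) \<and> y \<in> set (root_path l)"
proof -
  have V: "x \<in> pverts T" "y \<in> pverts T"
    using assms Q_pverts by blast+
  obtain l where l: "l \<in> P" "x \<in> set (root_path l)"
    using assms(1) by blast
  obtain l' where l': "l' \<in> P" "y \<in> set (root_path l')"
    using assms(2) by blast
  show ?thesis
  proof (cases "y \<in> set (root_path x)")
    case True
    then show ?thesis
      using root_path_suffix l by blast
  next
    case False
    note px = tree_path[OF root V(1)]
    have "y \<notin> set (tree_path T r x)"
      using False tree_path_rev[OF V(1) root] by simp
    then have "path (tree_path T r x @ [y])"
      using path_snoc[OF px(1)] px(3) assms(3) by simp
    then have "tree_path T r y = tree_path T r x @ [y]"
      by (rule tree_path_eq) (use px in auto)
    then have "x \<in> set (root_path y)"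
      using px(3,4) last_in_set[OF px(4)] tree_path_rev[OF root V(2)] by simp
    then show ?thesis
      using root_path_suffix l' by blast
  qed
qed

text \<open>The path from \<open>r\<close> through \<open>q\<close> to \<open>y\<close> would
  continue to a second attachment \<open>q'\<close>, and the root path of \<open>q'\<close>, which
  stays in \<open>Q\<close>, would contain \<open>y\<close>.\<close>

lemma single_attachment:
  assumes "y \<in> (\<Union>v\<in>Q. nbh T v) - Q"
  shows "\<exists>q\<in>Q. nbh T y \<inter> Q = {q}"
proof -
  have yQ: "y \<notin> Q"
    using assms by blast
  have "\<exists>q\<in>Q. (q, y) \<in> parcs T"
    using DiffD1[OF assms] unfolding mem_nbh[symmetric] by blast
  then obtain q where q: "q \<in> Q" "(q, y) \<in> parcs T"
    by blast
  have qV: "q \<in> pverts T"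
    using q(1) Q_pverts by blast
  note pq = tree_path[OF root qV]
  have pQ: "set (tree_path T r x) \<subseteq> Q" if "x \<in> Q" for x
  proof -
    have "x \<in> pverts T"
      using that Q_pverts by blast
    then show ?thesis
      using root_path_subset_Q[OF that] tree_path_rev[OF _ root, of x] by simp
  qed
  have py: "path (tree_path T r q @ [y])"
    using path_snoc[OF pq(1)] pq(3) q pQ[OF q(1)] yQ by auto
  have only: "q' = q" if q': "q' \<in> Q" "(y, q') \<in> parcs T" for q'
  proof (cases "q' \<in> set (tree_path T r q @ [y])")
    case True
    then obtain p' where "tree_path T r q @ [y] = p' @ [q', y]"
      using path_end_neighbour[OF py, of q'] q'(2) by auto
    then have "tree_path T r q = p' @ [q']"
      by simp
    then show ?thesis
      using pq(3) by simp
  next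
    case False
    then have "path ((tree_path T r q @ [y]) @ [q'])"
      using path_snoc[OF py, of q'] q'(2) by auto
    then have "tree_path T r q' = (tree_path T r q @ [y]) @ [q']"
      by (rule tree_path_eq) (use pq in auto)
    then show ?thesis
      using pQ[OF q'(1)] yQ by auto
  qed
  have "(y, q) \<in> parcs T"
    using q(2) arc_symT by blast
  have "nbh T y \<inter> Q = {q}"
  proof (intro equalityI subsetI)
    fix x assume "x \<in> nbh T y \<inter> Q"
    then show "x \<in> {q}"
      using only[of x] by simp
  next
    fix x assume "x \<in> {q}"
    then show "x \<in> nbh T y \<inter> Q"
      using q(1) \<open>(y, q) \<in> parcs T\<close> by simp
  qed
  then show ?thesis
    using q(1) by blast
qed

text \<open>The intersection node is the first common vertex, as an earlier one would be farther
  from the root. From there on both paths are the root path of \<open>c\<close>.\<close>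

lemma meet:
  assumes ij: "i \<in> P" "j \<in> P"
  defines "c \<equiv> intersection_node T r i j"
  shows "\<exists>B B'. root_path i = B @ root_path c \<and> root_path j = B' @ root_path c \<and> set B \<inter> set B' = {}"
    and "c \<in> set (root_path i) \<inter> set (root_path j)"
proof -
  let ?I = "set (root_path i) \<inter> set (root_path j)"
  have "finite ?I" "?I \<noteq> {}"
    using root_path(6) ij by auto
  note am = arg_max_on_finite[OF this, where f = "tree_dist T r"]
  show cI: "c \<in> ?I"
    using am(1) unfolding c_def intersection_node_def by blast
  have max: "tree_dist T r x \<le> tree_dist T r c" if "x \<in> ?I" for x
    using am(2)[OF that] unfolding c_def intersection_node_def by blast
  obtain B b where B: "root_path i = B @ c # b"
    using cI by (meson IntD1 split_list)
  obtain B' b' where B': "root_path j = B' @ c # b'"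
    using cI by (meson IntD2 split_list)
  have s: "root_path c = c # b" "root_path c = c # b'"
    using tree_path_split(2)[OF B] tree_path_split(2)[OF B'] ij party_pverts root by auto
  have "x \<notin> set B'" if x: "x \<in> set B" for x
  proof
    assume "x \<in> set B'"
    then have "x \<in> ?I"
      using x B B' by simp
    obtain a1 a2 where a: "B = a1 @ x # a2"
      using x by (meson split_list)
    have V: "x \<in> pverts T" "c \<in> pverts T"
      using \<open>x \<in> ?I\<close> cI Q_pverts ij by blast+
    have "root_path x = x # a2 @ c # b"
      using tree_path_split(2)[of i r a1 x "a2 @ c # b"] B ij party_pverts root by (simp add: a)
    then have "tree_dist T r c < tree_dist T r x"
      using s(1) tree_path_rev[OF _ root] V by (simp add: tree_dist_def)
    then show False
      using max[OF \<open>x \<in> ?I\<close>] by simp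
  qed
  then show "\<exists>B B'. root_path i = B @ root_path c \<and> root_path j = B' @ root_path c \<and> set B \<inter> set B' = {}"
    using B B' s by auto
qed

lemma intersection_node_commute: "intersection_node T r i j = intersection_node T r j i"
  by (simp add: intersection_node_def Int_commute)

lemma intersection_node_root:
  assumes "i \<in> P" "j \<in> P" "set (root_path i) \<inter> set (root_path j) = {r}"
  shows "intersection_node T r i j = r"
  using meet(2)[OF assms(1,2)] assms(3) by simp

text \<open>The shape in which \<open>r\<close> is the only intersection node. Two parties always
  have it, by \<open>root_paths_meet\<close>.\<close>

definition star :: bool where
  "star \<longleftrightarrow> (\<forall>i\<in>P. \<forall>j\<in>P. i \<noteq> j \<longrightarrow> set (root_path i) \<inter> set (root_path j) = {r})"

text \<open>
  The root lies on the leg of \<open>k\<close>, at some distance from the branch vertex \<open>c\<close>. One of the other two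
  parties may coincide with \<open>c\<close>; it is then called \<open>i\<close>.
\<close>

definition branching :: "'a \<Rightarrow> 'a \<Rightarrow> 'a \<Rightarrow> 'a \<Rightarrow> 'a list \<Rightarrow> 'a list \<Rightarrow> bool" where
  "branching i j k c B B' \<longleftrightarrow> P = {i, j, k} \<and> i \<noteq> j \<and> i \<noteq> k \<and> j \<noteq> k \<and> c \<noteq> r \<and> j \<noteq> c \<and>
     c \<in> pverts T \<and> intersection_node T r i j = c \<and>
     set (root_path i) \<inter> set (root_path k) = {r} \<and> set (root_path j) \<inter> set (root_path k) = {r} \<and>
     root_path i = B @ root_path c \<and> root_path j = B' @ root_path c \<and> set B \<inter> set B' = {}"

text \<open>If the path of \<open>i\<close> met that of \<open>k\<close> in some \<open>y\<close>
  other than \<open>r\<close>, then of \<open>x\<close> and \<open>y\<close>, both on the path of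
  \<open>i\<close>, the one nearer to the root would lie on all three paths.\<close>

lemma root_paths_disjoint:
  assumes ijk: "P = {i, j, k}" and x: "x \<in> set (root_path i) \<inter> set (root_path j)" "x \<noteq> r"
  shows "set (root_path i) \<inter> set (root_path k) = {r}"
proof (rule ccontr)
  have P: "i \<in> P" "j \<in> P" "k \<in> P"
    using ijk by auto
  assume "\<not> ?thesis"
  then obtain y where y: "y \<in> set (root_path i) \<inter> set (root_path k)" "y \<noteq> r"
    using root_path(6) P by blast
  obtain a b where ab: "root_path i = a @ x # b"
    using x by (meson IntD1 split_list)
  have sx: "root_path x = x # b"
    using tree_path_split(2)[OF ab] P party_pverts root by blast
  have "y \<in> set (root_path x) \<or> x \<in> set (root_path y)"
  proof (cases "y \<in> set (x # b)")
    case True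
    then show ?thesis
      using sx by simp
  next
    case False
    then have "y \<in> set a"
      using y ab by auto
    then obtain a1 a2 where a: "a = a1 @ y # a2"
      by (meson split_list)
    have "root_path y = y # a2 @ x # b"
      using tree_path_split(2)[of i r a1 y "a2 @ x # b"] ab P party_pverts root by (simp add: a)
    then show ?thesis
      by simp
  qed
  then have "\<exists>z. z \<noteq> r \<and> z \<in> (\<Inter>i\<in>P. set (root_path i))"
  proof
    assume "y \<in> set (root_path x)"
    then have "y \<in> set (root_path j)"
      using root_path_suffix[of x j] x P by blast
    then show ?thesis
      using y ijk by blast
  next
    assume "x \<in> set (root_path y)"
    then have "x \<in> set (root_path k)"
      using root_path_suffix[of y k] y P by blast
    then show ?thesis
      using x ijk by blast
  qed
  then show False
    using root_paths_meet by blast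
qed

lemma star_or_branching: "star \<or> (\<exists>i j k c B B'. branching i j k c B B')"
proof (cases star)
  case False
  then obtain i j where ij: "i \<in> P" "j \<in> P" "i \<noteq> j" "set (root_path i) \<inter> set (root_path j) \<noteq> {r}"
    unfolding star_def by blast
  have "P \<noteq> {i, j}"
    using ij(4) root_paths_meet by auto
  then obtain k where k: "k \<in> P" "k \<noteq> i" "k \<noteq> j"
    using ij by blast
  have "card {i, j, k} = 3"
    using ij k by simp
  then have P: "P = {i, j, k}"
    using card_subset_eq[OF finite_P, of "{i, j, k}"] card_mono[OF finite_P, of "{i, j, k}"]
      parties(3) ij k by auto
  define c where "c = intersection_node T r i j"
  obtain B B' where B: "root_path i = B @ root_path c" "root_path j = B' @ root_path c" "set B \<inter> set B' = {}"
    using meet(1)[OF ij(1,2)] unfolding c_def by blast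
  have c: "c \<in> set (root_path i) \<inter> set (root_path j)"
    using meet(2)[OF ij(1,2)] unfolding c_def .
  have cV: "c \<in> pverts T"
    using c Q_pverts ij by blast
  have "c \<noteq> r"
    using ij(4) B tree_path_refl[OF root] by auto
  have ik: "set (root_path i) \<inter> set (root_path k) = {r}"
    by (rule root_paths_disjoint[OF P c \<open>c \<noteq> r\<close>])
  have jk: "set (root_path j) \<inter> set (root_path k) = {r}"
    by (rule root_paths_disjoint[of j i k c]) (use P c \<open>c \<noteq> r\<close> in auto)
  have "\<exists>i j k c B B'. branching i j k c B B'"
  proof (cases "j = c")
    case True
    have "P = {j, i, k}" "i \<noteq> c" "j \<noteq> i" "j \<noteq> k" "i \<noteq> k" "set B' \<inter> set B = {}"
      using P ij(3) k True B(3) by blast+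
    moreover have "intersection_node T r j i = c"
      unfolding c_def by (rule intersection_node_commute)
    ultimately have "branching j i k c B' B"
      unfolding branching_def using \<open>c \<noteq> r\<close> cV ik jk B(1,2) by (intro conjI)
    then show ?thesis
      by blast
  next
    case False
    have "intersection_node T r i j = c" "i \<noteq> k" "j \<noteq> k"
      using c_def k by simp_all
    then have "branching i j k c B B'"
      unfolding branching_def using P ij(3) \<open>c \<noteq> r\<close> False cV ik jk B by (intro conjI)
    then show ?thesis
      by blast
  qed
  then show ?thesis ..
qed simp

section \<open>Neighbours inside the spanned subtree\<close>

lemma disjoint_pair: "\<exists>i\<in>P. \<exists>k\<in>P. i \<noteq> k \<and> set (root_path i) \<inter> set (root_path k) = {r}"
proof (cases star)
  case True
  obtain i where "i \<in> P"
    using party_exists by blast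
  moreover have "P \<noteq> {i}"
    using parties(2) by auto
  ultimately show ?thesis
    using True unfolding star_def by blast
next
  case False
  then obtain i j k c B B' where "branching i j k c B B'"
    using star_or_branching by blast
  then show ?thesis
    unfolding branching_def by blast
qed

lemma root_neighbour:
  assumes "i \<in> P" "i \<noteq> r"
  shows "\<exists>a\<in>set (root_path i). a \<noteq> r \<and> (r, a) \<in> parcs T"
proof -
  obtain q x where q: "root_path i = q @ [x]"
    using root_path(4)[OF assms(1)] by (meson rev_exhaust)
  then have "x = r" "q \<noteq> []"
    using root_path(2,3)[OF assms(1)] assms(2) by auto
  then obtain q' a where "root_path i = q' @ [a, r]"
    using q by (metis append.assoc append_Cons append_Nil rev_exhaust)
  then show ?thesis
    using root_path(1)[OF assms(1)] arc_symT[of a r]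
    by (auto simp: vpath_iff successively_append_iff)
qed

text \<open>Every leaf of \<open>Q\<close> is a party: an inner vertex of a root path has a
  predecessor and a successor, and a root outside \<open>P\<close> has neighbours on two disjoint
  root paths. \<open>nondeg_unit\<close> needs exactly this.\<close>

lemma two_neighbours:
  assumes "s \<in> Q - P"
  shows "\<exists>a\<in>Q. \<exists>b\<in>Q. a \<noteq> b \<and> (s, a) \<in> parcs T \<and> (s, b) \<in> parcs T"
proof (cases "s = r")
  case True
  obtain i k where ik: "i \<in> P" "k \<in> P" "set (root_path i) \<inter> set (root_path k) = {r}"
    using disjoint_pair by blast
  have "i \<noteq> r" "k \<noteq> r"
    using ik assms True by auto
  then obtain a b where a: "a \<in> set (root_path i)" "a \<noteq> r" "(r, a) \<in> parcs T"
    and b: "b \<in> set (root_path k)" "b \<noteq> r" "(r, b) \<in> parcs T"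
    using root_neighbour[OF ik(1)] root_neighbour[OF ik(2)] by blast
  have "a \<noteq> b"
    using a(1,2) b(1) ik(3) by blast
  moreover have "a \<in> Q" "b \<in> Q"
    using a(1) b(1) ik(1,2) by blast+
  ultimately show ?thesis
    using a(3) b(3) True by blast
next
  case False
  obtain i where i: "i \<in> P" "s \<in> set (root_path i)"
    using assms by blast
  obtain a b where ab: "root_path i = a @ s # b"
    using i(2) by (meson split_list)
  have "a \<noteq> []" "b \<noteq> []"
    using ab root_path(2,3)[OF i(1)] False assms i(1) by auto
  then have "(last a, s) \<in> parcs T" "(s, hd b) \<in> parcs T" "set a \<inter> set b = {}"
    using root_path(1)[OF i(1)] unfolding ab
    by (auto simp: vpath_iff successively_append_iff successively_Cons)
  moreover from this(3) have "last a \<noteq> hd b"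
    using last_in_set[OF \<open>a \<noteq> []\<close>] hd_in_set[OF \<open>b \<noteq> []\<close>] by (metis disjoint_iff)
  moreover have "last a \<in> Q" "hd b \<in> Q"
    using i(1) ab \<open>a \<noteq> []\<close> \<open>b \<noteq> []\<close> by (auto intro!: bexI[of _ i])
  ultimately show ?thesis
    using arc_symT by blast
qed

lemma Q_subset_nbh: "Q \<subseteq> (\<Union>v\<in>Q. nbh T v)"
proof
  fix q assume q: "q \<in> Q"
  have "\<exists>v\<in>Q. (q, v) \<in> parcs T"
  proof (cases "q \<in> P")
    case False
    then show ?thesis
      using two_neighbours[of q] q by blast
  next
    case True
    show ?thesis
    proof (cases "q = r")
      case r: True
      have "P \<noteq> {q}"
        using parties(2) by auto
      then obtain i where "i \<in> P" "i \<noteq> r"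
        using True r by blast
      then show ?thesis
        using root_neighbour[of i] r by blast
    next
      case False
      obtain x y p where p: "root_path q = x # y # p"
        using root_path_length[OF True False]
        by (cases "root_path q"; cases "tl (root_path q)") auto
      then have "(q, y) \<in> parcs T"
        using root_path(1,2)[OF True] by (auto simp: vpath_iff)
      moreover have "y \<in> Q"
        using True p by (auto intro!: bexI[of _ q])
      ultimately show ?thesis
        by blast
    qed
  qed
  then show "q \<in> (\<Union>v\<in>Q. nbh T v)"
    using arc_symT by (auto simp: nbh_def)
qed

section \<open>The paths of the X-protocol\<close>

lemma path_join:
  assumes "path (B @ s)" "path (B' @ s)" "s \<noteq> []" "set B \<inter> set B' = {}"
  shows "tree_path T (hd (B @ s)) (hd (B' @ s)) = B @ hd s # rev B'"
proof (rule tree_path_eq)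
  obtain c s' where s: "s = c # s'"
    using assms(3) by (cases s) auto
  have 1: "path (B @ [c])"
    using path_prefix[of "B @ [c]" s'] assms(1) s by simp
  have 2: "path (c # rev B')"
    using path_rev[OF path_prefix[of "B' @ [c]" s']] assms(2) s by simp
  show "path (B @ hd s # rev B')"
    using 1 2 assms(4) by (auto simp: vpath_iff successively_append_iff s)
  show "hd (B @ hd s # rev B') = hd (B @ s)"
    by (simp add: s hd_append)
  show "last (B @ hd s # rev B') = hd (B' @ s)"
    by (cases B') (simp_all add: s last_rev)
qed

lemma tree_path_disjoint:
  assumes "i \<in> P" "j \<in> P" "set (root_path i) \<inter> set (root_path j) = {r}"
  shows "set (tree_path T i j) = set (root_path i) \<union> set (root_path j)"
proof -
  obtain B where B: "root_path i = B @ [r]"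
    using root_path[OF assms(1)] by (metis append_butlast_last_id)
  obtain B' where B': "root_path j = B' @ [r]"
    using root_path[OF assms(2)] by (metis append_butlast_last_id)
  have "r \<notin> set B" "r \<notin> set B'"
    using path_distinct root_path(1) assms(1,2) B B' by fastforce+
  then have "set B \<inter> set B' = {}"
    using assms(3) B B' by auto
  then have "tree_path T (hd (B @ [r])) (hd (B' @ [r])) = B @ r # rev B'"
    using path_join[of B "[r]" B'] root_path(1)[OF assms(1)] root_path(1)[OF assms(2)] B B' by simp
  then have "tree_path T i j = B @ r # rev B'"
    using root_path(2)[OF assms(1)] root_path(2)[OF assms(2)] B B' by simp
  then show ?thesis
    using B B' by auto
qed

text \<open>Any two of the three paths between three parties already cover the spanned subtree, so
  every order of the parties gives the same set.\<close>

lemma x_path_eq_Q: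
  assumes "set ps = P" "distinct ps"
  shows "x_path T ps = Q"
proof -
  have len: "length ps = card P"
    using assms(1) distinct_card[OF assms(2)] by simp
  have sym: "set (tree_path T a b) = set (tree_path T b a)" if "a \<in> P" "b \<in> P" for a b
    using tree_path_rev[OF party_pverts[OF that(1)] party_pverts[OF that(2)]] by simp
  show ?thesis
  proof (cases star)
    case True
    have tp: "set (tree_path T a b) = set (root_path a) \<union> set (root_path b)"
      if "a \<in> P" "b \<in> P" "a \<noteq> b" for a b
      using tree_path_disjoint that True unfolding star_def by blast
    consider a b where "ps = [a, b]" | a b c where "ps = [a, b, c]"
      using len parties(2,3) by (auto simp: numeral_2_eq_2 numeral_3_eq_3 le_Suc_eq length_Suc_conv)
    then show ?thesis
    proof cases
      case 1
      then show ?thesis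
        using tp[of a b] assms by auto
    next
      case 2
      then show ?thesis
        using tp[of a b] tp[of b c] assms by auto
    qed
  next
    case False
    then obtain i j k c B B' where br: "branching i j k c B B'"
      using star_or_branching by blast
    note b = br[unfolded branching_def]
    have P: "i \<in> P" "j \<in> P" "k \<in> P"
      using b by auto
    have ik: "set (tree_path T i k) = set (root_path i) \<union> set (root_path k)"
      and jk: "set (tree_path T j k) = set (root_path j) \<union> set (root_path k)"
      using tree_path_disjoint P b by blast+
    have c: "root_path c \<noteq> []" "hd (root_path c) = c" "c \<in> set (root_path c)"
      using b tree_path[OF _ root, of c] hd_in_set[of "root_path c"] by auto
    have "path (B @ root_path c)" "path (B' @ root_path c)"
      using root_path(1)[OF P(1)] root_path(1)[OF P(2)] b by simp_all
    then have "tree_path T (hd (B @ root_path c)) (hd (B' @ root_path c)) = B @ hd (root_path c) # rev B'"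
      by (rule path_join) (use b c in simp_all)
    then have "tree_path T i j = B @ c # rev B'"
      using b c(2) root_path(2)[OF P(1)] root_path(2)[OF P(2)] by simp
    then have ij: "set (tree_path T i j) = set B \<union> {c} \<union> set B'"
      by auto
    have Q: "Q = set B \<union> set B' \<union> set (root_path c) \<union> set (root_path k)"
      using b by auto
    have ri: "set (root_path i) = set B \<union> set (root_path c)"
      and rj: "set (root_path j) = set B' \<union> set (root_path c)"
      using b by auto
    have "length ps = 3"
      using len b by simp
    then obtain x y z where ps: "ps = [x, y, z]"
      by (auto simp: numeral_3_eq_3 length_Suc_conv)
    have "x_path T ps = set (tree_path T x y) \<union> set (tree_path T y z)"
      by (simp add: ps)
    moreover have "{x, y, z} = {i, j, k}" "x \<noteq> y" "x \<noteq> z" "y \<noteq> z"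
      using assms ps b by auto
    then consider "x = i" "y = j" "z = k" | "x = i" "y = k" "z = j" | "x = j" "y = i" "z = k"
      | "x = j" "y = k" "z = i" | "x = k" "y = i" "z = j" | "x = k" "y = j" "z = i"
      by (metis insert_iff singletonD)
    then have "set (tree_path T x y) \<union> set (tree_path T y z) = Q"
      unfolding Q
      by cases (use ij ik jk ri rj c(3) sym[OF P(1,2)] sym[OF P(1,3)] sym[OF P(2,3)] in auto)
    ultimately show ?thesis
      by simp
  qed
qed

lemma x_protocol_count_eq:
  assumes "set ps = P" "distinct ps"
  shows "x_protocol_count T ps = (card Q - card P) + (card (\<Union>v\<in>Q. nbh T v) - card Q)"
  using assms distinct_card[OF assms(2)] by (simp add: x_protocol_count_def x_path_eq_Q Let_def)


section \<open>Runs of the protocol\<close>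

abbreviation "target i \<equiv> nearest_intersection T r P i"
abbreviation "route_path i \<equiv> tree_path T i (target i)"

section \<open>Intersection nodes and routing targets\<close>

lemma not_singleton: "\<exists>j\<in>P. j \<noteq> i"
proof -
  have "\<not> P \<subseteq> {i}"
    using parties(2) card_mono[of "{i}" P] by auto
  then show ?thesis
    by blast
qed

lemma root_path_butlast:
  assumes "i \<in> P"
  shows "r \<notin> set (butlast (root_path i))"
    and "set (root_path i) = insert r (set (butlast (root_path i)))"
  using set_butlast_last[OF path_distinct[OF root_path(1)] root_path(4)] root_path(3) assms
  by simp_all

lemma star_intersection_node:
  assumes star "i \<in> P" "j \<in> P" "i \<noteq> j"
  shows "intersection_node T r i j = r"
  using assms intersection_node_root unfolding star_def by blast

lemma star_intersection_nodes:
  assumes star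
  shows "intersection_nodes T r P = {r}"
proof -
  obtain i j where "i \<in> P" "j \<in> P" "i \<noteq> j"
    using party_exists not_singleton by blast
  then have "r \<in> intersection_nodes T r P"
    using star_intersection_node[OF assms, of i j] unfolding intersection_nodes_def
    by (intro CollectI exI[of _ i] exI[of _ j]) simp
  moreover have "intersection_nodes T r P \<subseteq> {r}"
    using star_intersection_node[OF assms] unfolding intersection_nodes_def by auto
  ultimately show ?thesis
    by blast
qed

lemma star_target:
  assumes star "i \<in> P" "i \<noteq> r"
  shows "target i = r"
proof -
  obtain j where "j \<in> P - {i}"
    using not_singleton by blast
  then have "intersection_node T r i ` (P - {i}) = {r}"
    using star_intersection_node[OF assms(1,2)] by (auto intro!: rev_image_eqI[of j])
  then have "intersection_node T r i ` (P - {i}) - {i} = {r}"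
    using assms(3) by simp
  then show ?thesis
    unfolding nearest_intersection_def by (auto intro: arg_min_on_eq)
qed

text \<open>\<open>B\<close> and \<open>B'\<close> are the legs of \<open>i\<close> and
  \<open>j\<close> without \<open>c\<close>. The facts split \<open>Q\<close> into these legs, the
  path from \<open>c\<close> to \<open>r\<close>, and the path of \<open>k\<close>, which meets the
  rest only in \<open>r\<close>.\<close>

lemma branching_facts:
  assumes "branching i j k c B B'"
  shows "P = {i, j, k}" "i \<noteq> j" "i \<noteq> k" "j \<noteq> k" "c \<noteq> r" "j \<noteq> c"
    and "root_path i = B @ root_path c" "root_path j = B' @ root_path c"
    and "path (root_path c)" "hd (root_path c) = c" "last (root_path c) = r"
      "c \<in> set (root_path c)" "r \<in> set (root_path c)" "2 \<le> length (root_path c)"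
    and "set B \<inter> set B' = {}" "set B \<inter> set (root_path c) = {}" "set B' \<inter> set (root_path c) = {}"
      "(set B \<union> set B' \<union> set (root_path c)) \<inter> set (root_path k) = {r}"
    and "i = c \<and> B = [] \<or> i \<noteq> c \<and> i \<in> set B \<and> hd B = i \<and> B \<noteq> []" "j \<in> set B'" "hd B' = j" "B' \<noteq> []"
    and "Q = set B \<union> set B' \<union> set (root_path c) \<union> set (root_path k)"
proof -
  note b = assms[unfolded branching_def]
  show P: "P = {i, j, k}" "i \<noteq> j" "i \<noteq> k" "j \<noteq> k" "c \<noteq> r" "j \<noteq> c"
    and ij: "root_path i = B @ root_path c" "root_path j = B' @ root_path c"
    and B: "set B \<inter> set B' = {}"
    using b by blast+
  have inP: "i \<in> P" "j \<in> P" "k \<in> P"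
    using P by auto
  have cV: "c \<in> pverts T"
    using b by blast
  note c = tree_path[OF cV root]
  show c1: "path (root_path c)" "hd (root_path c) = c" "last (root_path c) = r"
    using c by blast+
  show c2: "c \<in> set (root_path c)" "r \<in> set (root_path c)"
    using c hd_in_set[OF c(4)] last_in_set[OF c(4)] by simp_all
  show "2 \<le> length (root_path c)"
    using c P(5) by (cases "root_path c"; cases "tl (root_path c)") auto
  show Bs: "set B \<inter> set (root_path c) = {}" "set B' \<inter> set (root_path c) = {}"
    using path_distinct[OF root_path(1)[OF inP(1)]] path_distinct[OF root_path(1)[OF inP(2)]]
    unfolding ij by simp_all
  have "set (root_path i) \<inter> set (root_path k) = {r}" "set (root_path j) \<inter> set (root_path k) = {r}"
    using b by blast+
  then show "(set B \<union> set B' \<union> set (root_path c)) \<inter> set (root_path k) = {r}"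
    unfolding ij by auto
  have hdi: "hd (B @ root_path c) = i" and hdj: "hd (B' @ root_path c) = j"
    using root_path(2)[OF inP(1)] root_path(2)[OF inP(2)] unfolding ij .
  show "B' \<noteq> []"
    using hdj c1(2) P(6) by auto
  then show "hd B' = j" "j \<in> set B'"
    using hdj hd_in_set[of B'] by auto
  show "i = c \<and> B = [] \<or> i \<noteq> c \<and> i \<in> set B \<and> hd B = i \<and> B \<noteq> []"
  proof (cases "B = []")
    case True
    then show ?thesis
      using hdi c1(2) by simp
  next
    case False
    then have "hd B = i"
      using hdi by simp
    then show ?thesis
      using False hd_in_set[OF False] Bs(1) c2(1) by auto
  qed
  show "Q = set B \<union> set B' \<union> set (root_path c) \<union> set (root_path k)"
    unfolding P(1) by (auto simp: ij)
qed

lemma branching_intersection_node: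
  assumes "branching i j k c B B'"
  shows "intersection_node T r i j = c" "intersection_node T r j i = c"
    "intersection_node T r i k = r" "intersection_node T r k i = r"
    "intersection_node T r j k = r" "intersection_node T r k j = r"
proof -
  note b = assms[unfolded branching_def]
  have "i \<in> P" "j \<in> P" "k \<in> P"
    using b by auto
  then show ik: "intersection_node T r i k = r" and jk: "intersection_node T r j k = r"
    using intersection_node_root b by blast+
  show ij: "intersection_node T r i j = c"
    using b by blast
  show "intersection_node T r j i = c" "intersection_node T r k i = r" "intersection_node T r k j = r"
    using ij ik jk intersection_node_commute by metis+
qed

lemma branching_intersection_nodes:
  assumes "branching i j k c B B'"
  shows "intersection_nodes T r P = {c, r}"
proof -
  note P = branching_facts(1-4)[OF assms]
  show ?thesis
    unfolding intersection_nodes_def P(1)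
  proof (intro equalityI subsetI)
    fix x assume "x \<in> {intersection_node T r a b |a b. a \<in> {i, j, k} \<and> b \<in> {i, j, k} \<and> a \<noteq> b}"
    then show "x \<in> {c, r}"
      using branching_intersection_node[OF assms] by auto
  next
    fix x assume "x \<in> {c, r}"
    then show "x \<in> {intersection_node T r a b |a b. a \<in> {i, j, k} \<and> b \<in> {i, j, k} \<and> a \<noteq> b}"
    proof
      assume "x = c"
      then have "x = intersection_node T r i j"
        using branching_intersection_node(1)[OF assms] by simp
      then show ?thesis
        using P(2) by blast
    next
      assume "x \<in> {r}"
      then have "x = intersection_node T r i k"
        using branching_intersection_node(3)[OF assms] by simp
      then show ?thesis
        using P(3) by blast
    qed
  qed
qed

lemma branching_dist:
  assumes "root_path i = B @ root_path c" "i \<in> P" "c \<in> pverts T" "c \<noteq> r"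
  shows "tree_path T i c = B @ [c]" "tree_dist T i c < tree_dist T i r"
proof -
  note c = tree_path[OF assms(3) root]
  obtain b where b: "root_path c = c # b" "b \<noteq> []"
    using c assms(4) by (cases "root_path c"; cases "tl (root_path c)") auto
  show "tree_path T i c = B @ [c]"
    using tree_path_split(1)[of i r B c b] assms b party_pverts root by simp
  then show "tree_dist T i c < tree_dist T i r"
    using assms(1) b by (simp add: tree_dist_def)
qed

text \<open>The candidates for \<open>i\<close> are \<open>c\<close> and \<open>r\<close>, and
  \<open>c\<close> is nearer. A party sitting at \<open>c\<close> may not be its own target, so it
  goes to \<open>r\<close>. For \<open>k = r\<close> no candidate is left and
  \<open>arg_min_on\<close> is unspecified; such a party is not routed.\<close>

lemma branching_target:
  assumes br: "branching i j k c B B'"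
  shows "i \<noteq> c \<Longrightarrow> target i = c" "i = c \<Longrightarrow> target i = r" "target j = c"
    "k \<noteq> r \<Longrightarrow> target k = r"
    and "i \<noteq> c \<Longrightarrow> route_path i = B @ [c]" "route_path j = B' @ [c]"
proof -
  note f = branching_facts[OF br]
  note n = branching_intersection_node[OF br]
  have P: "i \<in> P" "j \<in> P" "k \<in> P" and cV: "c \<in> pverts T"
    using f(1) br unfolding branching_def by auto
  have sets: "P - {i} = {j, k}" "P - {j} = {i, k}" "P - {k} = {i, j}"
    using f(1-4) by auto
  have "i \<noteq> r" "j \<noteq> r"
    using f(5,13,16,17,19,20) by blast+
  have dist_i: "tree_dist T i c < tree_dist T i r" and dist_j: "tree_dist T j c < tree_dist T j r"
    using branching_dist(2) f(5,7,8) P cV by blast+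
  show ti: "target i = c" if "i \<noteq> c"
    unfolding nearest_intersection_def sets
    by (rule arg_min_on_eq) (use n that dist_i in auto)
  show "target i = r" if "i = c"
    unfolding nearest_intersection_def sets
    by (rule arg_min_on_eq) (use n that f(5) in auto)
  show tj: "target j = c"
    unfolding nearest_intersection_def sets
    by (rule arg_min_on_eq) (use n f(6) dist_j in auto)
  show "target k = r" if "k \<noteq> r"
    unfolding nearest_intersection_def sets
    by (rule arg_min_on_eq) (use n that in auto)
  show "route_path i = B @ [c]" if "i \<noteq> c"
    using ti[OF that] branching_dist(1)[OF f(7) P(1) cV f(5)] by simp
  show "route_path j = B' @ [c]"
    using tj branching_dist(1)[OF f(8) P(2) cV f(5)] by simp
qed

section \<open>The routes form a routable list\<close>

lemma star_routable:
  assumes star "distinct qs" "set qs = P - {r}"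
  shows "routable T Q (map root_path qs)"
proof (rule routableI)
  fix p assume "p \<in> set (map root_path qs)"
  then obtain q where q: "p = root_path q" "q \<in> P" "q \<noteq> r"
    using assms(3) by auto
  then show "chordless T p \<and> 2 \<le> length p \<and> set p \<subseteq> Q"
    using chordless_path root_path root_path_length by blast
next
  fix ps1 p ps2 assume "map root_path qs = ps1 @ p # ps2"
  then obtain qs1 q qs2 where q: "qs = qs1 @ q # qs2" "ps1 = map root_path qs1" "p = root_path q"
    by (auto simp: map_eq_append_conv map_eq_Cons_conv)
  have qP: "q \<in> P"
    using q(1) assms(3) by auto
  have other: "q' \<in> P" "q' \<noteq> q" if "q' \<in> set qs1" for q'
    using that q(1) assms(2,3) by auto
  have "set (root_path q) \<inter> set (butlast (root_path q')) = {}" if "q' \<in> set qs1" for q'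
  proof -
    have "set (root_path q) \<inter> set (root_path q') = {r}"
      using assms(1) other[OF that] qP unfolding star_def by blast
    then show ?thesis
      using root_path_butlast[OF other(1)[OF that]] by auto
  qed
  then show "set p \<inter> bodies ps1 = {}"
    using q by auto
  fix x y assume xy: "x \<in> set (butlast p)" "y \<in> Q - bodies ps1" "(x, y) \<in> parcs T"
  then have x: "x \<in> set (root_path q)" "x \<noteq> r"
    using root_path_butlast[OF qP] q(3) by auto
  have "x \<in> Q" "y \<in> Q"
    using x(1) qP xy(2) by blast+
  then obtain l where l: "l \<in> P" "x \<in> set (root_path l)" "y \<in> set (root_path l)"
    using common_root_path xy(3) by blast
  \<comment> \<open>A vertex other than \<open>r\<close> lies on one root path only, so its
    neighbours in \<open>Q\<close> lie on the same path.\<close>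
  have "l = q"
    using assms(1) x l qP unfolding star_def by blast
  then show "y \<in> set p"
    using l q(3) by simp
qed

text \<open>The order matters only if \<open>i = c\<close>. Then the route of \<open>i\<close>
  follows the path from \<open>c\<close> to \<open>r\<close>, while \<open>c\<close> still has a
  neighbour on the leg of \<open>j\<close> and is the end of the route of \<open>j\<close>; the leg
  of \<open>j\<close> must be contracted before.\<close>

lemma branching_routable:
  assumes br: "branching i j k c B B'"
    and qs: "distinct qs" "set qs = P - {r}"
      "sorted_wrt (\<lambda>i j. i \<in> intersection_nodes T r P \<longrightarrow> j \<in> intersection_nodes T r P) qs"
  shows "routable T Q (map route_path qs)"
proof -
  note f = branching_facts[OF br]
  note t = branching_target[OF br]
  let ?S = "set (root_path c)" and ?K = "set (root_path k)"
  have P: "i \<in> P" "j \<in> P" "k \<in> P"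
    using f(1) by auto
  have rj: "r \<noteq> j" and rB: "r \<notin> set B" "r \<notin> set B'"
    using f(13,16,17,20) by blast+
  have s_ne: "root_path c \<noteq> []"
    using f(14) by auto
  note s_split = set_butlast_last[OF path_distinct[OF f(9)] s_ne, unfolded f(11)]
  have path_c: "route_path i = root_path c" if "i = c"
    using t(2)[OF that] that by simp
  have path_k: "route_path k = root_path k" if "k \<noteq> r"
    using t(4)[OF that] by simp
  have bi: "set (butlast (route_path i)) = set B" "set (route_path i) = insert c (set B)" if "i \<noteq> c"
    using t(5)[OF that] by simp_all
  have bj: "set (butlast (route_path j)) = set B'" "set (route_path j) = insert c (set B')"
    using t(6) by simp_all
  have ri: "set (root_path i) = set B \<union> ?S" and rj': "set (root_path j) = set B' \<union> ?S"
    by (simp_all add: f(7,8))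
  have onlyK: "x = r" if x: "x \<in> set B \<or> x \<in> set B' \<or> x \<in> ?S" "x \<in> ?K" for x
  proof -
    have "x \<in> (set B \<union> set B' \<union> ?S) \<inter> ?K"
      using x by blast
    then show ?thesis
      unfolding f(18) by simp
  qed
  have common: "\<exists>l\<in>{i, j, k}. x \<in> set (root_path l) \<and> y \<in> set (root_path l)"
    if "x \<in> Q" "y \<in> Q" "(x, y) \<in> parcs T" for x y
    using common_root_path[OF that] f(1) by simp
  have adj_B: "y \<in> insert c (set B)" if xy: "x \<in> set B" "y \<in> Q" "(x, y) \<in> parcs T" for x y
  proof -
    have "x \<in> Q"
      using xy(1) f(23) by blast
    then obtain l where l: "l \<in> {i, j, k}" "x \<in> set (root_path l)" "y \<in> set (root_path l)"
      using common[of x y] xy by blast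
    have "x \<notin> set (root_path j)" "x \<notin> set (root_path k)"
      unfolding rj' using f(15,16) onlyK[of x] xy(1) rB(1) by blast+
    then have "l = i"
      using l by blast
    then have "y \<in> set B \<union> ?S"
      using l f(7) by simp
    then show ?thesis
      using chordless_append_arc[of B "root_path c" x y] chordless_path[OF root_path(1)[OF P(1)]]
        xy f(7,10) by auto
  qed
  have adj_B': "y \<in> insert c (set B')" if xy: "x \<in> set B'" "y \<in> Q" "(x, y) \<in> parcs T" for x y
  proof -
    have "x \<in> Q"
      using xy(1) f(23) by blast
    then obtain l where l: "l \<in> {i, j, k}" "x \<in> set (root_path l)" "y \<in> set (root_path l)"
      using common[of x y] xy by blast
    have "x \<notin> set (root_path i)" "x \<notin> set (root_path k)"
      unfolding ri using f(15,17) onlyK[of x] xy(1) rB(2) by blast+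
    then have "l = j"
      using l by blast
    then have "y \<in> set B' \<union> ?S"
      using l f(8) by simp
    then show ?thesis
      using chordless_append_arc[of B' "root_path c" x y] chordless_path[OF root_path(1)[OF P(2)]]
        xy f(8,10) by auto
  qed
  have adj_S: "y \<in> ?S \<union> set B \<union> set B'" if xy: "x \<in> ?S" "x \<noteq> r" "y \<in> Q" "(x, y) \<in> parcs T" for x y
  proof -
    have "x \<in> Q"
      using xy(1) f(23) by blast
    then obtain l where l: "l \<in> {i, j, k}" "x \<in> set (root_path l)" "y \<in> set (root_path l)"
      using common[of x y] xy by blast
    have "l \<noteq> k"
      using l onlyK[of x] xy(1,2) by blast
    then show ?thesis
      using l ri rj' by blast
  qed
  have adj_K: "y \<in> ?K" if xy: "x \<in> ?K" "x \<noteq> r" "y \<in> Q" "(x, y) \<in> parcs T" for x y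
  proof -
    have "x \<in> Q"
      using xy(1) f(23) by blast
    then obtain l where l: "l \<in> {i, j, k}" "x \<in> set (root_path l)" "y \<in> set (root_path l)"
      using common[of x y] xy by blast
    have "x \<notin> set (root_path i)" "x \<notin> set (root_path j)"
      unfolding ri rj' using onlyK[of x] xy(1,2) by blast+
    then have "l = k"
      using l by blast
    then show ?thesis
      using l by simp
  qed
  show ?thesis
  proof (rule routableI)
    fix p assume "p \<in> set (map route_path qs)"
    then obtain q where q: "p = route_path q" "q \<in> P" "q \<noteq> r"
      using qs(2) by auto
    then consider "q = i" "i \<noteq> c" | "q = i" "i = c" | "q = j" | "q = k" "k \<noteq> r"
      using f(1) by blast
    then show "chordless T p \<and> 2 \<le> length p \<and> set p \<subseteq> Q"
    proof cases
      case 1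
      have "chordless T (B @ [c])" "2 \<le> length (B @ [c])"
        using chordless_path[OF path_tree_path] party_pverts[OF P(1)] t(1,5)[OF 1(2)] br 1 f(19)
        unfolding branching_def by (metis, cases B, auto)
      then show ?thesis
        using 1 t(5) q(1) f(12,23) by auto
    next
      case 2
      then show ?thesis
        using path_c chordless_path[OF f(9)] f(14,23) q(1) by auto
    next
      case 3
      have "chordless T (B' @ [c])" "2 \<le> length (B' @ [c])"
        using chordless_path[OF path_tree_path] party_pverts[OF P(2)] t(3,6) br f(22)
        unfolding branching_def by (metis, cases B', auto)
      then show ?thesis
        using 3 t(6) q(1) f(12,23) by auto
    next
      case 4
      then show ?thesis
        using path_k chordless_path[OF root_path(1)[OF P(3)]] root_path_length[OF P(3)] f(23) q(1)
        by auto
    qed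
  next
    fix ps1 p ps2 assume "map route_path qs = ps1 @ p # ps2"
    then obtain qs1 q qs2 where q: "qs = qs1 @ q # qs2" "ps1 = map route_path qs1" "p = route_path q"
      by (auto simp: map_eq_append_conv map_eq_Cons_conv)
    have q1: "q \<in> P" "q \<noteq> r" "q \<notin> set qs1" "set qs1 \<subseteq> P - {r}"
      using q(1) qs(1,2) by auto
    let ?A = "intersection_nodes T r P"
    have "\<forall>x\<in>set qs1. x \<in> ?A \<longrightarrow> q \<in> ?A" "\<forall>y\<in>set qs2. q \<in> ?A \<longrightarrow> y \<in> ?A"
      using qs(3)[unfolded q(1) sorted_wrt_append sorted_wrt.simps list.set] by blast+
    note sorted = this
    \<comment> \<open>\<open>i\<close> is an intersection node and \<open>j\<close> is not, so the
      prescribed order puts \<open>j\<close> before \<open>i\<close>.\<close>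
    have first: "i \<notin> set qs1 \<and> (q = i \<longrightarrow> j \<in> set qs1)" if ic: "i = c" "q = i \<or> q = j"
    proof -
      have "j \<in> set qs"
        using qs(2) P(2) rj by blast
      then have "j \<in> set qs1 \<or> j = q \<or> j \<in> set qs2"
        using q(1) by auto
      moreover have "i \<in> ?A" "j \<notin> ?A"
        unfolding branching_intersection_nodes[OF br] using ic(1) f(6) rj by blast+
      ultimately show ?thesis
        using sorted ic(2) f(2) q1(3) by blast
    qed
    have bod: "bodies ps1 = (\<Union>q\<in>set qs1. set (butlast (route_path q)))"
      using q(2) by auto
    from q1(1,2) consider "q = i" "i \<noteq> c" | "q = i" "i = c" | "q = j" | "q = k" "k \<noteq> r"
      using f(1) by blast
    note cases = this
    \<comment> \<open>Different routes share at most \<open>c\<close> and \<open>r\<close>. No body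
      contains \<open>r\<close>, and \<open>c\<close> lies in a body only if \<open>i = c\<close>,
      the case settled by \<open>first\<close>.\<close>
    have "x \<notin> set (butlast (route_path q'))" if x: "x \<in> set (route_path q)" and q': "q' \<in> set qs1" for x q'
    proof
      assume x': "x \<in> set (butlast (route_path q'))"
      have "q' \<noteq> q"
        using q' q1(3) by blast
      have "q' = i \<and> i \<noteq> c \<or> q' = i \<and> i = c \<or> q' = j \<or> q' = k \<and> k \<noteq> r"
        using q' q1(4) f(1) by blast
      then have "(q' = i \<and> i \<noteq> c \<and> x \<in> set B) \<or> (q' = i \<and> i = c \<and> x \<in> ?S \<and> x \<noteq> r) \<or>
          (q' = j \<and> x \<in> set B') \<or> (q' = k \<and> x \<in> ?K \<and> x \<noteq> r)"
        using x' path_c path_k bi(1) bj(1) s_split root_path_butlast[OF P(3)] by (elim disjE) auto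
      moreover have "(q = i \<and> i \<noteq> c \<and> (x = c \<or> x \<in> set B)) \<or> (q = i \<and> i = c \<and> x \<in> ?S) \<or>
          (q = j \<and> (x = c \<or> x \<in> set B')) \<or> (q = k \<and> x \<in> ?K)"
        using cases x path_c path_k bi(2) bj(2) by cases auto
      moreover have "x \<in> set B \<Longrightarrow> x \<notin> set B' \<and> x \<notin> ?S" "x \<in> set B' \<Longrightarrow> x \<notin> ?S"
        "x = c \<Longrightarrow> x \<in> ?S \<and> x \<noteq> r"
        using f(5,12,15,16,17) by blast+
      ultimately show False
        using onlyK[of x] rB \<open>q' \<noteq> q\<close> first q' by (elim disjE conjE) simp_all
    qed
    then show "set p \<inter> bodies ps1 = {}"
      unfolding q(3) bod by blast
    fix x y assume xy: "x \<in> set (butlast p)" "y \<in> Q - bodies ps1" "(x, y) \<in> parcs T"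
    have yQ: "y \<in> Q"
      using xy(2) by blast
    from cases show "y \<in> set p"
    proof cases
      case 1
      then show ?thesis
        using adj_B[OF _ yQ xy(3)] xy(1) bi q(3) by simp
    next
      case 2
      then have "j \<in> set qs1" "B = []"
        using first f(19) by blast+
      moreover from this(1) have "y \<notin> set B'"
        using xy(2) bj(1) unfolding bod by blast
      moreover have "x \<in> ?S" "x \<noteq> r"
        using xy(1) s_split path_c[OF 2(2)] q(3) 2 by auto
      ultimately show ?thesis
        using adj_S[OF _ _ yQ xy(3)] path_c[OF 2(2)] q(3) 2 by auto
    next
      case 3
      then show ?thesis
        using adj_B'[OF _ yQ xy(3)] xy(1) bj q(3) by simp
    next
      case 4
      then show ?thesis
        using adj_K[OF _ _ yQ xy(3)] xy(1) root_path_butlast[OF P(3)] path_k[OF 4(2)] q(3) by auto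
    qed
  qed
qed

abbreviation before_root :: "'a measurement list \<Rightarrow> bool" where
  "before_root ms \<equiv> \<exists>vws. ms = X_measures vws \<and> executable ms T \<and> distinct (consumed P vws) \<and>
     set (consumed P vws) = Q - P - {r} \<and>
     (r \<notin> P \<longrightarrow> (\<exists>x\<in>P. (x, r) \<in> parcs (measure_all ms T)))"

lemma target_pverts: "i \<in> P \<Longrightarrow> i \<noteq> r \<Longrightarrow> target i \<in> pverts T"
proof -
  assume i: "i \<in> P" "i \<noteq> r"
  show ?thesis
  proof (cases star)
    case True
    then show ?thesis
      using star_target[OF True i] root by simp
  next
    case False
    then obtain i' j k c B B' where br: "branching i' j k c B B'"
      using star_or_branching by blast
    have "c \<in> pverts T"
      using br unfolding branching_def by blast
    then show ?thesis
      using branching_target[OF br] branching_facts(1)[OF br] i root by (cases "i' = c") auto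
  qed
qed

lemma routing_step_X_measures:
  assumes "set qs = P - {r}"
  shows "concat (map (route T r P) qs) = X_measures (concat (map route_pairs (map route_path qs)))"
proof -
  have "map (route T r P) qs = map (\<lambda>q. X_measures (route_pairs (route_path q))) qs"
  proof (rule map_cong[OF refl])
    fix q assume "q \<in> set qs"
    then have "q \<in> P" "q \<noteq> r"
      using assms by auto
    then have "hd (route_path q) = q"
      using hd_tree_path party_pverts target_pverts by blast
    then show "route T r P q = X_measures (route_pairs (route_path q))"
      by (simp add: route_def comp_def)
  qed
  then have "concat (map (route T r P) qs)
      = concat (map (\<lambda>q. X_measures (route_pairs (route_path q))) qs)"
    by (rule arg_cong)
  also have "\<dots> = X_measures (concat (map route_pairs (map route_path qs)))"
    by (simp add: map_concat comp_def)
  finally show ?thesis .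
qed

lemma routing_step_exists: "\<exists>ms. routing_step T r P ms"
proof -
  obtain xs where xs: "distinct xs" "set xs = P - {r}"
    using finite_distinct_list[of "P - {r}"] finite_P by auto
  let ?A = "intersection_nodes T r P"
  let ?qs = "filter (\<lambda>i. i \<notin> ?A) xs @ filter (\<lambda>i. i \<in> ?A) xs"
  have sorted: "sorted_wrt (\<lambda>i j. i \<in> ?A \<longrightarrow> j \<in> ?A) ys" if "set ys \<subseteq> ?A \<or> set ys \<inter> ?A = {}" for ys
    using that by (induction ys) auto
  have "sorted_wrt (\<lambda>i j. i \<in> ?A \<longrightarrow> j \<in> ?A) (filter (\<lambda>i. i \<notin> ?A) xs)"
    by (rule sorted) auto
  moreover have "sorted_wrt (\<lambda>i j. i \<in> ?A \<longrightarrow> j \<in> ?A) (filter (\<lambda>i. i \<in> ?A) xs)"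
    by (rule sorted) auto
  ultimately have "sorted_wrt (\<lambda>i j. i \<in> ?A \<longrightarrow> j \<in> ?A) ?qs"
    unfolding sorted_wrt_append by auto
  moreover have "distinct ?qs" "set ?qs = P - {r}"
    using xs by auto
  ultimately show ?thesis
    unfolding routing_step_def by blast
qed

text \<open>Routing alone suffices: each root path shrinks to an arc between its party and
  \<open>r\<close>.\<close>

lemma star_before_root:
  assumes star "routing_step T r P ms"
  shows "before_root ms"
proof -
  obtain qs where qs: "distinct qs" "set qs = P - {r}" "ms = concat (map (route T r P) qs)"
    using assms(2) unfolding routing_step_def by blast
  have paths: "map route_path qs = map root_path qs"
    using star_target[OF assms(1)] qs(2) by (intro map_cong refl) auto
  define ps where "ps = map root_path qs"
  have ms: "ms = X_measures (concat (map route_pairs ps))"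
    using routing_step_X_measures[OF qs(2)] qs(3) paths by (simp add: ps_def)
  have rt: "routable T Q ps"
    unfolding ps_def by (rule star_routable[OF assms(1) qs(1,2)])
  have bod: "bodies ps = (\<Union>q\<in>P - {r}. set (butlast (root_path q)))"
    by (simp add: ps_def qs(2))
  have r_bod: "r \<notin> bodies ps"
    unfolding bod using root_path_butlast(1) by blast
  have Qb: "Q = insert r (bodies ps)"
  proof (intro equalityI subsetI)
    fix x assume "x \<in> Q"
    then obtain i where i: "i \<in> P" "x \<in> set (root_path i)"
      by blast
    show "x \<in> insert r (bodies ps)"
    proof (cases "i = r")
      case True
      then show ?thesis
        using i tree_path_refl[OF root] by simp
    next
      case False
      then show ?thesis
        using i root_path_butlast(2)[OF i(1)] unfolding bod by auto
    qed
  next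
    fix x assume "x \<in> insert r (bodies ps)"
    then show "x \<in> Q"
      using r_in_Q routable_bodies[OF rt] by blast
  qed
  \<comment> \<open>A further party on the root path of \<open>q\<close> would lie on two root paths
    and hence be \<open>r\<close>, which is the end of the path and not interior.\<close>
  have interior: "hd p \<in> P \<and> set (interior p) \<inter> P = {}" if p: "p \<in> set ps" for p
  proof -
    obtain q where q: "p = root_path q" "q \<in> P" "q \<noteq> r"
      using p qs(2) by (auto simp: ps_def)
    have "x \<notin> P" if x: "x \<in> set (interior p)" for x
    proof
      assume "x \<in> P"
      have x': "x \<in> set (butlast (root_path q))" "x \<noteq> q"
        using x set_interior[OF path_distinct[OF root_path(1)[OF q(2)]]] root_path(2)[OF q(2)] q(1)
        by auto
      have "x \<in> set (root_path q) \<inter> set (root_path x)"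
        using in_set_butlastD[OF x'(1)] root_path(5)[OF \<open>x \<in> P\<close>] by blast
      then have "x = r"
        using assms(1) q(2) \<open>x \<in> P\<close> x'(2) unfolding star_def by blast
      then show False
        using x'(1) root_path_butlast(1)[OF q(2)] by blast
    qed
    then show ?thesis
      using root_path(2)[OF q(2)] q by auto
  qed
  note rts = routings[OF pair_graph_T rt refl, folded ms]
  have "\<exists>x\<in>P. (x, r) \<in> parcs (measure_all ms T)" if rP: "r \<notin> P"
  proof -
    obtain q where q: "q \<in> P" "q \<noteq> r"
      using party_exists rP by blast
    then have "root_path q \<in> set ps"
      using qs(2) by (simp add: ps_def)
    then have "(hd (root_path q), r) \<in> parcs (measure_all ms T)"
      using rts(4)[of "root_path q" r] r_bod root_path(3)[OF q(1)] r_in_Q by simp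
    then show ?thesis
      using q root_path(2)[OF q(1)] by auto
  qed
  moreover have "distinct (consumed P (concat (map route_pairs ps)))"
    "set (consumed P (concat (map route_pairs ps))) = Q - P - {r}"
    using consumed_routes[OF rt interior] Qb r_bod by auto
  ultimately show ?thesis
    using rts(1) ms by blast
qed

text \<open>If \<open>i = c\<close>, the routes already use up everything except \<open>r\<close>.
  Otherwise the path from \<open>c\<close> to \<open>r\<close> survives as an induced path; in it
  \<open>i\<close> and \<open>j\<close> see only \<open>c\<close>, and a routed \<open>k\<close>
  sees only \<open>r\<close>, which is the situation of \<open>connect_to_root\<close>.\<close>

lemma branching_before_root:
  assumes br: "branching i j k c B B'" and ms4: "routing_step T r P ms4"
  shows "i = c \<Longrightarrow> before_root ms4"
    and "i \<noteq> c \<Longrightarrow> \<exists>ms5. connect_to_root T r P (measure_all ms4 T) c ms5"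
    and "i \<noteq> c \<Longrightarrow> connect_to_root T r P (measure_all ms4 T) c ms5 \<Longrightarrow> before_root (ms4 @ ms5)"
proof -
  obtain qs where qs: "distinct qs" "set qs = P - {r}"
      "sorted_wrt (\<lambda>i j. i \<in> intersection_nodes T r P \<longrightarrow> j \<in> intersection_nodes T r P) qs"
      "ms4 = concat (map (route T r P) qs)"
    using ms4 unfolding routing_step_def by blast
  define ps where "ps = map route_path qs"
  have ms: "ms4 = X_measures (concat (map route_pairs ps))"
    using routing_step_X_measures[OF qs(2)] qs(4) by (simp add: ps_def)
  have rt: "routable T Q ps"
    unfolding ps_def by (rule branching_routable[OF br qs(1,2,3)])
  note rts = routings[OF pair_graph_T rt refl, folded ms]
  let ?G = "measure_all ms4 T"
  have G: "pair_graph ?G"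
    by (rule pair_graph_measure_all[OF pair_graph_T])
  note f = branching_facts[OF br]
  note t = branching_target[OF br]
  let ?s = "root_path c" and ?K = "root_path k"
  have P: "i \<in> P" "j \<in> P" "k \<in> P"
    using f(1) by auto
  have rB: "r \<notin> set B" "r \<notin> set B'"
    using f(13,16,17) by blast+
  have neq: "r \<noteq> j" "r \<noteq> i"
    using rB f(5,19,20) by blast+
  have onlyK: "x = r" if x: "x \<in> set B \<or> x \<in> set B' \<or> x \<in> set ?s" "x \<in> set ?K" for x
  proof -
    have "x \<in> (set B \<union> set B' \<union> set ?s) \<inter> set ?K"
      using x by blast
    then show ?thesis
      unfolding f(18) by simp
  qed
  have s_ne: "?s \<noteq> []" and s_dist: "distinct ?s"
    using f(14) path_distinct[OF f(9)] by auto
  note s_split = set_butlast_last[OF s_dist s_ne, unfolded f(11)]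
  have K_split: "set ?K = insert r (set (butlast ?K))" "r \<notin> set (butlast ?K)"
    using root_path_butlast[OF P(3)] by blast+
  \<comment> \<open>If \<open>k\<close> is the root, it has no route, and its root path has an empty
    body; so one formula for the bodies serves both cases.\<close>
  have K_r: "set (butlast ?K) = {}" if "k = r"
    using that tree_path_refl[OF root] by simp
  have path_c: "route_path i = ?s" if "i = c"
    using t(2)[OF that] that by simp
  have path_k: "route_path k = ?K" if "k \<noteq> r"
    using t(4)[OF that] by simp
  have paths: "p \<in> set ps \<longleftrightarrow> p = route_path i \<or> p = route_path j \<or> p = route_path k \<and> k \<noteq> r" for p
  proof -
    have "set qs = {i, j} \<union> (if k = r then {} else {k})"
      using qs(2) f(1) neq by auto
    then show ?thesis
      by (auto simp: ps_def)
  qed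
  have K_body: "(if k \<noteq> r then set (butlast (route_path k)) else {}) = set (butlast ?K)"
    using path_k K_r by auto
  have bod: "bodies ps = set (butlast (route_path i)) \<union> set B' \<union> set (butlast ?K)"
  proof -
    have "bodies ps = set (butlast (route_path i)) \<union> set (butlast (route_path j)) \<union>
        (if k \<noteq> r then set (butlast (route_path k)) else {})"
      using paths by auto
    then show ?thesis
      unfolding K_body using t(6) by simp
  qed
  have P_disj: "j \<notin> set B \<and> j \<notin> set ?s \<and> j \<notin> set (butlast ?K)" "i \<notin> set B'" "i \<notin> set (butlast ?K)"
    "k \<notin> set B \<and> k \<notin> set B' \<and> k \<notin> set (butlast ?s)"
  proof -
    have "j \<notin> set ?K" "i \<notin> set ?K"
      using onlyK[of j] onlyK[of i] neq f(12,19,20) by blast+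
    then show "j \<notin> set B \<and> j \<notin> set ?s \<and> j \<notin> set (butlast ?K)" "i \<notin> set (butlast ?K)"
      using f(15,17,20) in_set_butlastD[of _ ?K] by blast+
    show "i \<notin> set B'"
      using f(12,15,17,19) by blast
    show "k \<notin> set B \<and> k \<notin> set B' \<and> k \<notin> set (butlast ?s)"
      using onlyK[of k] root_path(5)[OF P(3)] rB s_split in_set_butlastD[of k ?s] by blast
  qed
  have K_int: "set (interior ?K) = set (butlast ?K) - {k}"
    using set_interior[OF path_distinct[OF root_path(1)[OF P(3)]]] root_path(2)[OF P(3)] by simp
  have j_int: "set (interior (route_path j)) = set B' - {j}" "hd (route_path j) = j"
    using set_interior[of "B' @ [c]"] path_distinct[OF root_path(1)[OF P(2)]] t(6) f(8,12,17,21,22)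
    by auto
  have i_hd: "hd (route_path i) = i"
    using path_c t(5) f(10,19) by (cases "i = c") auto
  have i_int: "set (interior (route_path i)) = set (butlast (route_path i)) - {i}"
  proof -
    have "i \<noteq> r" "target i \<in> pverts T"
      using neq target_pverts P(1) by blast+
    then have "distinct (route_path i)"
      using path_distinct[OF path_tree_path] party_pverts[OF P(1)] by blast
    then show ?thesis
      using set_interior i_hd by metis
  qed
  have i_body: "set (butlast (route_path i)) = (if i = c then set (butlast ?s) else set B)"
    using path_c t(5) by simp
  have interior: "hd p \<in> P \<and> set (interior p) \<inter> P = {}" if p: "p \<in> set ps" for p
  proof -
    have "j \<notin> set (butlast ?s)"
      using P_disj(1) in_set_butlastD[of j ?s] by blast
    then have 1: "set (interior (route_path i)) \<inter> {i, j, k} = {}"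
      unfolding i_int i_body using P_disj by auto
    have 2: "set (interior (route_path j)) \<inter> {i, j, k} = {}"
      unfolding j_int using P_disj by auto
    have 3: "set (interior ?K) \<inter> {i, j, k} = {}"
      unfolding K_int using P_disj by auto
    have "p = route_path i \<or> p = route_path j \<or> p = ?K"
      using p paths path_k by auto
    then show ?thesis
      using 1[folded f(1)] 2[folded f(1)] 3[folded f(1)] i_hd j_int(2) root_path(2)[OF P(3)] P by auto
  qed
  have cons: "distinct (consumed P (concat (map route_pairs ps)))"
    "set (consumed P (concat (map route_pairs ps))) = bodies ps - P"
    using consumed_routes[OF rt] interior by blast+
  have r_bod: "r \<notin> bodies ps"
    unfolding bod i_body using s_split rB K_split by simp
  have QK: "Q = set B \<union> set B' \<union> set ?s \<union> set (butlast ?K)"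
    unfolding f(23) using K_split(1) f(13) by auto
  show "before_root ms4" if ic: "i = c"
  proof -
    have "Q = insert r (bodies ps)"
      unfolding bod i_body QK using ic f(19) s_split(1) by auto
    then have "set (consumed P (concat (map route_pairs ps))) = Q - P - {r}"
      using cons(2) r_bod by auto
    moreover have "(i, r) \<in> parcs ?G"
    proof -
      have "route_path i \<in> set ps" "last (route_path i) = r"
        using paths[of "route_path i"] path_c[OF ic] f(11) by simp_all
      then show ?thesis
        using rts(4)[of "route_path i" r] r_bod r_in_Q i_hd by simp
    qed
    ultimately show ?thesis
      using rts(1) ms cons(1) P(1) by blast
  qed
  have body5: "bodies ps = set B \<union> set B' \<union> set (butlast ?K)" if "i \<noteq> c"
    using bod i_body that by simp
  have S: "Q - bodies ps = set ?s" if "i \<noteq> c"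
  proof -
    have "x \<notin> set (butlast ?K)" if "x \<in> set ?s" for x
      using onlyK[of x] that K_split in_set_butlastD[of x ?K] by blast
    then show ?thesis
      unfolding body5[OF that] QK using f(16,17) by blast
  qed
  have c_notin: "c \<notin> bodies ps" if "i \<noteq> c"
    using S[OF that] f(12) by blast
  have ij_nbh: "(x, y) \<in> parcs ?G \<longleftrightarrow> y = c" if "i \<noteq> c" "x = i \<or> x = j" "y \<in> set ?s" for x y
  proof -
    have "route_path i \<in> set ps \<and> hd (route_path i) = i \<and> last (route_path i) = c"
      using paths[of "route_path i"] i_hd t(5)[OF that(1)] by simp
    moreover have "route_path j \<in> set ps \<and> hd (route_path j) = j \<and> last (route_path j) = c"
      using paths[of "route_path j"] j_int(2) t(6) by simp
    ultimately have "route_path x \<in> set ps" "hd (route_path x) = x" "last (route_path x) = c"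
      using that(2) by blast+
    then show ?thesis
      using rts(4)[of "route_path x" y] c_notin[OF that(1)] S[OF that(1)] that(3) by simp
  qed
  have k_nbh: "(k, y) \<in> parcs ?G \<longleftrightarrow> y = r" if "i \<noteq> c" "k \<noteq> r" "y \<in> set ?s" for y
  proof -
    have "route_path k \<in> set ps" "hd (route_path k) = k" "last (route_path k) = r"
      using paths[of "route_path k"] path_k[OF that(2)] that(2) root_path(2,3)[OF P(3)] by simp_all
    then show ?thesis
      using rts(4)[of "route_path k" y] r_bod S[OF that(1)] that(3) by simp
  qed
  have ch: "chordless ?G ?s" if "i \<noteq> c"
  proof -
    have "(x, y) \<in> parcs ?G \<longleftrightarrow> (x, y) \<in> parcs T" if xy: "x \<in> set ?s" "y \<in> set ?s" for x y
      using rts(2)[of x y] xy unfolding S[OF \<open>i \<noteq> c\<close>] by blast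
    then show ?thesis
      using chordless_cong[of ?s ?G T] chordless_path[OF f(9)] by blast
  qed
  have i_notin: "i \<notin> set ?s" if "i \<noteq> c"
    using that f(16,19) by blast
  show "\<exists>ms5. connect_to_root T r P ?G c ms5" if ic: "i \<noteq> c"
  proof -
    have "(c, i) \<in> parcs ?G"
      using ij_nbh[OF ic, of i c] f(12) arc_sym[OF G] by blast
    then have "i \<in> P \<inter> nbh ?G c"
      using P(1) by simp
    then show ?thesis
      unfolding connect_to_root_def Let_def
      by (cases "even (length ?s)") (simp_all only: if_True if_False simp_thms, blast)
  qed
  show "before_root (ms4 @ ms5)" if ic: "i \<noteq> c" and ms5: "connect_to_root T r P ?G c ms5"
  proof -
    have "set (butlast ?s) \<inter> P = {}"
      using f(1) P_disj i_notin[OF ic] in_set_butlastD[of _ ?s] by auto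
    moreover have "(x \<notin> set ?s \<and> (\<forall>y\<in>set ?s. (x, y) \<in> parcs ?G \<longleftrightarrow> y = c)) \<or> (x = r \<and> length ?s = 2)"
      if x: "x \<in> P" "(c, x) \<in> parcs ?G" for x
    proof -
      have xc: "(x, c) \<in> parcs ?G"
        using x(2) arc_sym[OF G] by blast
      consider "x = i" | "x = j" | "x = k" "k \<noteq> r" | "x = k" "k = r"
        using x(1) f(1) by blast
      then show ?thesis
      proof cases
        case 1
        then show ?thesis
          using ij_nbh[OF ic] i_notin[OF ic] by blast
      next
        case 2
        then show ?thesis
          using ij_nbh[OF ic] P_disj(1) by blast
      next
        case 3
        then show ?thesis
          using k_nbh[OF ic 3(2) f(12)] xc f(5) by blast
      next
        \<comment> \<open>The party root is adjacent to \<open>c\<close>, and the path is induced,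
          so \<open>r\<close> comes directly after \<open>c\<close> and the path has two
          vertices.\<close>
        case 4
        have "?s = c # tl ?s" "tl ?s \<noteq> []"
          using f(10,14) s_ne by (cases ?s; simp; fastforce)+
        then obtain b where b: "?s = c # b" "b \<noteq> []"
          by blast
        then have "r = hd b"
          using ch[OF ic] x(2) 4 f(5,11,13) by auto
        then have "tl b = []"
          using b f(11) s_dist by (cases b) (auto split: if_splits)
        then show ?thesis
          using 4 b by (cases b) auto
      qed
    qed
    ultimately obtain vws where vws: "ms5 = X_measures vws" "executable ms5 ?G" "distinct (consumed P vws)"
      "set (consumed P vws) = set (butlast ?s)"
      "r \<notin> P \<longrightarrow> (\<exists>x\<in>P. (x, r) \<in> parcs (measure_all ms5 ?G))"
      using connect_to_root[OF G ch[OF ic] refl f(10,11,14) _ P(1) i_notin[OF ic] _ _ ms5] ij_nbh[OF ic]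
      by blast
    have disj: "set (butlast ?s) \<inter> bodies ps = {}"
      using S[OF ic] in_set_butlastD[of _ ?s] by blast
    have "Q = insert r (set (butlast ?s)) \<union> bodies ps"
      using S[OF ic] s_split(1) routable_bodies[OF rt] by blast
    \<comment> \<open>Stated for set variables, so that the identity is decided without unfolding
      \<open>Q\<close> and the bodies.\<close>
    moreover have "Y - P \<union> X = Z - P - {r}"
      if "Z = insert r X \<union> Y" "X \<inter> P = {}" "r \<notin> X" "r \<notin> Y" for X Y Z
      using that by blast
    ultimately have "set (consumed P (concat (map route_pairs ps) @ vws)) = Q - P - {r}"
      unfolding consumed_append cons(2) vws(4)
      using \<open>set (butlast ?s) \<inter> P = {}\<close> s_split(2) r_bod by metis
    moreover have "distinct (consumed P (concat (map route_pairs ps) @ vws))"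
      unfolding consumed_append cons(2) vws(4) using cons(1) vws(3) disj by blast
    moreover have "ms4 @ ms5 = X_measures (concat (map route_pairs ps) @ vws)"
      using ms vws(1) by simp
    moreover have "executable (ms4 @ ms5) T"
      using rts(1) vws(2) by simp
    moreover have "r \<notin> P \<longrightarrow> (\<exists>x\<in>P. (x, r) \<in> parcs (measure_all (ms4 @ ms5) T))"
      using vws(5) by simp
    ultimately show ?thesis
      by blast
  qed
qed

lemma mem_consumed:
  "vw \<in> set vws \<Longrightarrow> fst vw \<in> set (consumed P vws) \<and> (snd vw \<in> P \<or> snd vw \<in> set (consumed P vws))"
  unfolding consumed_def by auto

text \<open>The shape of the tree decides which alternative of \<open>intersection_step\<close>
  applies: one intersection node in a star, and otherwise the two nodes \<open>c\<close> and
  \<open>r\<close>, with \<open>c\<close> a party or not.\<close>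

lemma before_root_run:
  assumes ms4: "routing_step T r P ms4" and ms5: "intersection_step T r P (measure_all ms4 T) ms5"
  shows "before_root (ms4 @ ms5)"
proof (cases star)
  case True
  then have "ms5 = []"
    using ms5 star_intersection_nodes unfolding intersection_step_def Let_def by auto
  then show ?thesis
    using star_before_root[OF True ms4] by simp
next
  case False
  then obtain i j k c B B' where br: "branching i j k c B B'"
    using star_or_branching by blast
  note f = branching_facts[OF br]
  \<comment> \<open>\<open>j\<close> differs from \<open>c\<close> by the choice of names, and
    \<open>k = c\<close> would make \<open>c\<close> a common vertex with the path of
    \<open>k\<close>, that is, \<open>r\<close>.\<close>
  have P: "c \<in> P \<longleftrightarrow> i = c"
    using f(1,6,12,18) root_path(5)[of k] f(5) by blast
  have A: "intersection_nodes T r P = {c, r}" "card {c, r} \<noteq> 1"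
    using branching_intersection_nodes[OF br] f(5) by simp_all
  show ?thesis
  proof (cases "i = c")
    case True
    then have "ms5 = []"
      using ms5 A P unfolding intersection_step_def Let_def by auto
    then show ?thesis
      using branching_before_root(1)[OF br ms4 True] by simp
  next
    case False
    then have "connect_to_root T r P (measure_all ms4 T) c ms5"
      using ms5 A P unfolding intersection_step_def Let_def by auto
    then show ?thesis
      using branching_before_root(3)[OF br ms4 False] by blast
  qed
qed

section \<open>Existence and count of complete runs\<close>

lemma intersection_step_exists:
  assumes "routing_step T r P ms4"
  shows "\<exists>ms5. intersection_step T r P (measure_all ms4 T) ms5"
proof (cases star)
  case True
  then show ?thesis
    using star_intersection_nodes unfolding intersection_step_def Let_def by auto
next
  case False
  then obtain i j k c B B' where br: "branching i j k c B B'"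
    using star_or_branching by blast
  note f = branching_facts[OF br]
  have A: "c \<in> intersection_nodes T r P"
    using branching_intersection_nodes[OF br] by simp
  show ?thesis
  proof (cases "c \<in> P")
    case True
    then show ?thesis
      using A f(5) unfolding intersection_step_def Let_def by blast
  next
    case False
    then have "i \<noteq> c"
      using f(1) by blast
    then show ?thesis
      using branching_before_root(2)[OF br assms] A f(5) False
      unfolding intersection_step_def Let_def by blast
  qed
qed

lemma steps_exist:
  "\<exists>ms4 ms5 ms6 ms7. routing_step T r P ms4 \<and> intersection_step T r P (measure_all ms4 T) ms5 \<and>
     root_step r P (measure_all (ms4 @ ms5) T) ms6 \<and>
     isolating_step P (measure_all (ms4 @ ms5 @ ms6) T) ms7"
proof -
  obtain ms4 where ms4: "routing_step T r P ms4"
    using routing_step_exists by blast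
  obtain ms5 where ms5: "intersection_step T r P (measure_all ms4 T) ms5"
    using intersection_step_exists[OF ms4] by blast
  have "\<exists>ms6. root_step r P (measure_all (ms4 @ ms5) T) ms6"
  proof (cases "r \<in> P")
    case False
    then obtain x where "x \<in> P" "(x, r) \<in> parcs (measure_all (ms4 @ ms5) T)"
      using before_root_run[OF ms4 ms5] by blast
    then have "x \<in> P \<inter> nbh (measure_all (ms4 @ ms5) T) r"
      unfolding Int_iff mem_nbh using arc_sym[OF pair_graph_measure_all[OF pair_graph_T]] by blast
    then show ?thesis
      using False unfolding root_step_def by (simp only: if_False) blast
  qed (simp add: root_step_def)
  then obtain ms6 where ms6: "root_step r P (measure_all (ms4 @ ms5) T) ms6"
    by blast
  let ?G = "measure_all (ms4 @ ms5 @ ms6) T"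
  have G: "pair_graph ?G"
    by (rule pair_graph_measure_all[OF pair_graph_T])
  have "(\<Union>i\<in>P. nbh ?G i) - P \<subseteq> pverts ?G"
    using arc_in_pverts[OF G] by (auto simp del: measure_all_append)
  moreover have "finite (pverts ?G)"
    using G unfolding pair_graph_iff by blast
  ultimately have "finite ((\<Union>i\<in>P. nbh ?G i) - P)"
    by (rule finite_subset)
  from finite_distinct_list[OF this]
  obtain zs where "distinct zs" "set zs = (\<Union>i\<in>P. nbh ?G i) - P"
    by blast
  then have "isolating_step P ?G (map Z_meas zs)"
    unfolding isolating_step_def by blast
  then show ?thesis
    using ms4 ms5 ms6 by blast
qed

lemma steps_count:
  assumes ps: "set ps = P" "distinct ps"
    and ms4: "routing_step T r P ms4" and ms5: "intersection_step T r P (measure_all ms4 T) ms5"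
    and ms6: "root_step r P (measure_all (ms4 @ ms5) T) ms6"
    and ms7: "isolating_step P (measure_all (ms4 @ ms5 @ ms6) T) ms7"
  shows "executable (ms4 @ ms5 @ ms6 @ ms7) T" "length (ms4 @ ms5 @ ms6 @ ms7) = x_protocol_count T ps"
proof -
  obtain vws where vws: "ms4 @ ms5 = X_measures vws" "executable (ms4 @ ms5) T"
    "distinct (consumed P vws)" "set (consumed P vws) = Q - P - {r}"
    using before_root_run[OF ms4 ms5] by blast
  have "\<exists>vws6. ms6 = X_measures vws6 \<and> executable ms6 (measure_all (ms4 @ ms5) T) \<and>
    consumed P vws6 = (if r \<in> P then [] else [r])"
  proof (cases "r \<in> P")
    case True
    then show ?thesis
      using ms6 by (intro exI[of _ "[]"]) (simp add: root_step_def consumed_def)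
  next
    case False
    then obtain x where x: "x \<in> P" "(r, x) \<in> parcs (measure_all (ms4 @ ms5) T)" "ms6 = [X_meas r x]"
      using ms6 by (auto simp: root_step_def simp del: measure_all_append)
    moreover have "r \<in> pverts (measure_all (ms4 @ ms5) T)"
      using arc_in_pverts[OF pair_graph_measure_all[OF pair_graph_T] x(2)] by blast
    ultimately show ?thesis
      using False by (intro exI[of _ "[(r, x)]"]) (auto simp: consumed_def simp del: measure_all_append)
  qed
  then obtain vws6 where vws6: "ms6 = X_measures vws6" "executable ms6 (measure_all (ms4 @ ms5) T)"
    "consumed P vws6 = (if r \<in> P then [] else [r])"
    by blast
  let ?v = "vws @ vws6"
  have ms: "X_measures ?v = ms4 @ ms5 @ ms6"
    using vws(1) vws6(1) by simp
  have exec: "executable (X_measures ?v) T"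
    using vws(2) vws6(2) unfolding ms by simp
  have dist: "distinct (consumed P ?v)"
    unfolding consumed_append vws6(3) vws(4) using vws(3) by simp
  \<comment> \<open>The root step uses up the root unless it is a party, which completes the
    hypothesis of the counting lemma.\<close>
  have set_c: "set (consumed P ?v) = Q - P"
    unfolding consumed_append vws6(3) vws(4) using r_in_Q by auto
  have sub: "set ?v \<subseteq> Q \<times> Q"
  proof
    fix vw assume vw: "vw \<in> set ?v"
    have "fst vw \<in> set (consumed P ?v)" "snd vw \<in> P \<or> snd vw \<in> set (consumed P ?v)"
      using mem_consumed[OF vw] by blast+
    then have "fst vw \<in> Q" "snd vw \<in> Q"
      unfolding set_c using P_subset_Q by blast+
    then show "vw \<in> Q \<times> Q"
      by (simp add: mem_Times_iff)
  qed
  note count = isolating_step_count[OF pair_graph_T finite_Q P_subset_Q Q_subset_nbh exec sub dist set_c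
      single_attachment nondeg_unit[OF P_subset_Q Q_pverts _ two_neighbours] ms7[folded ms]]
  show "executable (ms4 @ ms5 @ ms6 @ ms7) T"
    using count(1) unfolding ms by simp
  show "length (ms4 @ ms5 @ ms6 @ ms7) = x_protocol_count T ps"
    using count(2) x_protocol_count_eq[OF ps] unfolding ms by simp
qed

end

text \<open>The existence of a run keeps the universal part from being vacuous. \<open>ps\<close>
  lists the parties in an arbitrary order, since the X-protocol is defined through an order.\<close>

theorem theorem4:
  fixes T :: "'a pair_pre_digraph" and r :: 'a and P :: "'a set" and ps :: "'a list"
  assumes "undirected_tree T"
    and "r \<in> pverts T"
    and "P \<subseteq> pverts T"
    and "2 \<le> card P" and "card P \<le> 3"
    and "set ps = P" and "distinct ps"
  shows "(\<exists>ms. dodag_x_run T r P ms) \<and>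
         (\<forall>ms. dodag_x_run T r P ms \<longrightarrow>
            executable ms T \<and> length ms = x_protocol_count T ps)"
proof -
  interpret tree_graph T
    by unfold_locales (rule assms(1))
  have "P \<noteq> {}"
    using assms(4) by auto
  note nr = new_root[OF assms(2,3) this]
  interpret rooted_parties T "new_root T r P" P
    by unfold_locales (use nr assms(3-5) in auto)
  show ?thesis
    using steps_exist steps_count[OF assms(6,7)] unfolding dodag_x_run_def Let_def by blast
qed

end
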